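(* Let $n\ge2$ and let $\mathcal{H}(n)$ be the group with generators $x_1,\dots,x_n,y_1,\dots,y_n$ and defining relations, for all $x,x'\in X_0=\{x_1,\dots,x_n\}$, $y,y'\in Y_0=\{y_1,\dots,y_n\}$, $z,z',z'',z'''\in X_0\cup Y_0$: $z^2=1$, $[x,x']=[y,y']=1$, $[x,y]^2=1$, $[[y,x],y']=1$, $[[x,y],z]^2=1$, $[[[z,z'],z''],z''']=1$. Let $X=\langle X_0\rangle$, $Y=\langle Y_0\rangle$, and let $\mathcal{H}(n)_3=[[\mathcal{H}(n),\mathcal{H}(n)],\mathcal{H}(n)]$ be the third term of the lower central series. Then: (1) for all $x,x'\in X_0$ and $y\in Y_0$, $[[x,y],x']=[[x',y],x]$; (2) $\mathcal{H}(n)/\mathcal{H}(n)'\cong C_2^{2n}$, and $\mathcal{H}(n)$ is an $n$-dimensional mixed dihedral group relative to $X$ and $Y$; (3) $\mathcal{H}(n)'=W\times\mathcal{H}(n)_3\cong C_2^{n^2(n+1)/2}$, where (a) $W=\langle [x_i,y_j]:1\le i,j\le n\rangle\cong C_2^{n^2}$, and (b) $\mathcal{H}(n)_3=\langle [[x_i,y_j],x_k]: 1\le i,j\le n,\ i<k\le n\rangle\cong C_2^{n^2(n-1)/2}$; moreover $\mathcal{H}(n)_3\le Z(\mathcal{H}(n))$; (4) for all $a\in\mathcal{H}(n)$ and $b,b'\in Y$, $[[b,a],b']=1$ and $[[a,b],b']=1$; (5) for every $(g_1,g_2)\in\mathrm{Aut}(X)\times\mathrm{Aut}(Y)$, the map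 $x_i\mapsto x_i^{g_1}$, $y_i\mapsto y_i^{g_2}$ ($1\le i\le n$) extends to an automorphism of $\mathcal{H}(n)$; (6) if $c\in X$ and $d\in Y$ are written as $c=x_{i_1}x_{i_2}\cdots x_{i_k}$ and $d=y_{j_1}y_{j_2}\cdots y_{j_\ell}$ with $x_{i_u}\in X_0$, $y_{j_v}\in Y_0$ and $k,\ell$ minimal, then \[ [c,d]\,\mathcal{H}(n)_3=\prod_{1\le u\le k,\ 1\le v\le \ell}[x_{i_u},y_{j_v}]\,\mathcal{H}(n)_3. \]
   Context: Commutators: $[a,b]=a^{-1}b^{-1}ab$; $\mathcal{H}(n)'$ is the derived subgroup; $Z(\cdot)$ is the centre. A finite group $H$ with subgroups $X,Y$ is an $n$-dimensional mixed dihedral group relative to $X$ and $Y$ if $X\cong Y\cong C_2^n$, $H=\langle X,Y\rangle$ and $H/H'\cong C_2^{2n}$. *)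

theory Defs
  imports "HOL-Algebra.Product_Groups" "HOL-Algebra.Bij"
begin

section \<open>Groups given by generators and relators\<close>

text \<open>A word is a list of letters; the letter \<open>(a, False)\<close> stands for the generator \<open>a\<close> and
  \<open>(a, True)\<close> for its formal inverse.\<close>

type_synonym 'a word = "('a \<times> bool) list"

definition words :: "'a set \<Rightarrow> 'a word set" where
  "words S = {w. fst ` set w \<subseteq> S}"

definition winv :: "'a word \<Rightarrow> 'a word" where
  "winv w = rev (map (\<lambda>(a, e). (a, \<not> e)) w)"

text \<open>The least congruence on the free monoid of words that cancels every generator against its
  inverse and kills every relator.\<close>

inductive pres_eq :: "'a set \<Rightarrow> 'a word set \<Rightarrow> 'a word \<Rightarrow> 'a word \<Rightarrow> bool"
  for S :: "'a set" and R :: "'a word set" where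
  cancel: "a \<in> S \<Longrightarrow> pres_eq S R [(a, e), (a, \<not> e)] []"
| relator: "r \<in> R \<Longrightarrow> pres_eq S R r []"
| refl: "u \<in> words S \<Longrightarrow> pres_eq S R u u"
| sym: "pres_eq S R u v \<Longrightarrow> pres_eq S R v u"
| trans: "pres_eq S R u v \<Longrightarrow> pres_eq S R v w \<Longrightarrow> pres_eq S R u w"
| append: "pres_eq S R u u' \<Longrightarrow> pres_eq S R v v' \<Longrightarrow> pres_eq S R (u @ v) (u' @ v')"

definition pres_rel :: "'a set \<Rightarrow> 'a word set \<Rightarrow> ('a word \<times> 'a word) set" where
  "pres_rel S R = {(u, v). pres_eq S R u v}"

text \<open>The group \<open>\<langle>S | r = 1 for r \<in> R\<rangle>\<close>; it is meant for \<open>R \<subseteq> words S\<close>.\<close>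

definition presented_group :: "'a set \<Rightarrow> 'a word set \<Rightarrow> 'a word set monoid" where
  "presented_group S R =
     \<lparr>carrier = words S // pres_rel S R,
      monoid.mult = (\<lambda>A B. \<Union>u\<in>A. \<Union>v\<in>B. pres_rel S R `` {u @ v}),
      one = pres_rel S R `` {[]}\<rparr>"

lemma pres_eq_words:
  assumes "R \<subseteq> words S" "pres_eq S R u v"
  shows "u \<in> words S" "v \<in> words S"
proof -
  have "u \<in> words S \<and> v \<in> words S"
    using assms(2,1) by (induction rule: pres_eq.induct) (auto simp: words_def)
  then show "u \<in> words S" "v \<in> words S" by auto
qed

lemma equiv_pres_rel:
  assumes "R \<subseteq> words S"
  shows "equiv (words S) (pres_rel S R)"
proof (rule equivI)
  show "pres_rel S R \<subseteq> words S \<times> words S"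
    using pres_eq_words[OF assms] by (auto simp: pres_rel_def)
  show "refl_on (words S) (pres_rel S R)"
    by (auto simp: refl_on_def pres_rel_def intro: pres_eq.refl)
  show "sym (pres_rel S R)"
    by (auto simp: sym_def pres_rel_def intro: pres_eq.sym)
  show "trans (pres_rel S R)"
    by (auto simp: trans_def pres_rel_def intro: pres_eq.trans)
qed

lemma presented_group_mult:
  assumes "R \<subseteq> words S" "u \<in> words S" "v \<in> words S"
  shows "pres_rel S R `` {u} \<otimes>\<^bsub>presented_group S R\<^esub> pres_rel S R `` {v} = pres_rel S R `` {u @ v}"
proof -
  have "congruent2 (pres_rel S R) (pres_rel S R) (\<lambda>u v. pres_rel S R `` {u @ v})"
  proof (rule congruent2I')
    fix u u' v v' assume "(u, u') \<in> pres_rel S R" "(v, v') \<in> pres_rel S R"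
    then have "(u @ v, u' @ v') \<in> pres_rel S R"
      by (auto simp: pres_rel_def intro: pres_eq.append)
    then show "pres_rel S R `` {u @ v} = pres_rel S R `` {u' @ v'}"
      by (rule equiv_class_eq[OF equiv_pres_rel[OF assms(1)]])
  qed
  from UN_equiv_class2[OF equiv_pres_rel[OF assms(1)] equiv_pres_rel[OF assms(1)] this assms(2,3)]
  show ?thesis by (simp add: presented_group_def)
qed

lemma pres_eq_winv:
  assumes "u \<in> words S"
  shows "pres_eq S R (winv u @ u) []"
  using assms
proof (induction u)
  case Nil
  then show ?case by (auto simp: winv_def words_def intro: pres_eq.refl)
next
  case (Cons p u)
  obtain a e where p: "p = (a, e)" by force
  have a: "a \<in> S" and u: "u \<in> words S" using Cons.prems p by (auto simp: words_def)
  have w: "winv u \<in> words S" using u by (force simp: words_def winv_def)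
  have "pres_eq S R ([(a, \<not> e), (a, e)] @ u) ([] @ u)"
    using pres_eq.cancel[OF a, of R "\<not> e"] pres_eq.refl[OF u] by (intro pres_eq.append) auto
  from pres_eq.append[OF pres_eq.refl[OF w] this]
  have "pres_eq S R (winv (p # u) @ p # u) (winv u @ u)" by (simp add: winv_def p)
  then show ?case using Cons.IH[OF u] by (rule pres_eq.trans)
qed

lemma group_presented_group:
  assumes "R \<subseteq> words S"
  shows "group (presented_group S R)"
proof -
  let ?G = "presented_group S R" and ?c = "\<lambda>u. pres_rel S R `` {u}"
  have carrier: "carrier ?G = ?c ` words S"
    by (auto simp: presented_group_def quotient_def)
  have one: "\<one>\<^bsub>?G\<^esub> = ?c []" by (simp add: presented_group_def)
  have wf: "[] \<in> words S" "\<And>u v. u \<in> words S \<Longrightarrow> v \<in> words S \<Longrightarrow> u @ v \<in> words S"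
    "\<And>u. u \<in> words S \<Longrightarrow> winv u \<in> words S"
    by (force simp: words_def winv_def)+
  note m = presented_group_mult[OF assms]
  show ?thesis
  proof (rule groupI)
    fix x assume "x \<in> carrier ?G"
    then obtain u where u: "u \<in> words S" "x = ?c u" by (auto simp: carrier)
    have "?c (winv u @ u) = ?c []"
      using pres_eq_winv[OF u(1)] equiv_class_eq[OF equiv_pres_rel[OF assms]]
      by (simp add: pres_rel_def)
    then have "?c (winv u) \<otimes>\<^bsub>?G\<^esub> x = \<one>\<^bsub>?G\<^esub>" by (simp add: one u m wf)
    then show "\<exists>y\<in>carrier ?G. y \<otimes>\<^bsub>?G\<^esub> x = \<one>\<^bsub>?G\<^esub>" using wf(3)[OF u(1)] by (auto simp: carrier)
  qed (auto simp: carrier one m wf)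
qed


section \<open>Group-theoretic notions\<close>

text \<open>The convention \<open>[a,b] = a\<inverse>b\<inverse>ab\<close>. The library's \<^const>\<open>derived\<close> is generated by the elements
  \<open>aba\<inverse>b\<inverse>\<close>, which gives the same derived subgroup of \<^term>\<open>carrier G\<close>.\<close>

definition commutator :: "('a, 'b) monoid_scheme \<Rightarrow> 'a \<Rightarrow> 'a \<Rightarrow> 'a" where
  "commutator G a b = inv\<^bsub>G\<^esub> a \<otimes>\<^bsub>G\<^esub> inv\<^bsub>G\<^esub> b \<otimes>\<^bsub>G\<^esub> a \<otimes>\<^bsub>G\<^esub> b"

definition commutator_subgroup :: "('a, 'b) monoid_scheme \<Rightarrow> 'a set \<Rightarrow> 'a set \<Rightarrow> 'a set" where
  "commutator_subgroup G A B = generate G {commutator G a b |a b. a \<in> A \<and> b \<in> B}"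

definition lower_central_3 :: "('a, 'b) monoid_scheme \<Rightarrow> 'a set" where
  "lower_central_3 G = commutator_subgroup G (derived G (carrier G)) (carrier G)"

definition centre :: "('a, 'b) monoid_scheme \<Rightarrow> 'a set" where
  "centre G = {z \<in> carrier G. \<forall>g\<in>carrier G. z \<otimes>\<^bsub>G\<^esub> g = g \<otimes>\<^bsub>G\<^esub> z}"

definition internal_direct_product :: "('a, 'b) monoid_scheme \<Rightarrow> 'a set \<Rightarrow> 'a set \<Rightarrow> bool" where
  "internal_direct_product G A B \<longleftrightarrow>
     A \<lhd> G \<and> B \<lhd> G \<and> A \<inter> B = {\<one>\<^bsub>G\<^esub>} \<and> A <#>\<^bsub>G\<^esub> B = carrier G"

text \<open>The elementary abelian group of rank \<open>m\<close>, as the \<open>m\<close>-fold direct power of the integers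
  modulo 2.\<close>

definition C2_pow :: "nat \<Rightarrow> (nat \<Rightarrow> int) monoid" where
  "C2_pow m = product_group {..<m} (\<lambda>_. integer_mod_group 2)"

definition mixed_dihedral :: "nat \<Rightarrow> ('a, 'b) monoid_scheme \<Rightarrow> 'a set \<Rightarrow> 'a set \<Rightarrow> bool" where
  "mixed_dihedral n H X Y \<longleftrightarrow>
     group H \<and> finite (carrier H) \<and> subgroup X H \<and> subgroup Y H \<and>
     H\<lparr>carrier := X\<rparr> \<cong> C2_pow n \<and> H\<lparr>carrier := Y\<rparr> \<cong> C2_pow n \<and>
     carrier H = generate H (X \<union> Y) \<and>
     H Mod derived H (carrier H) \<cong> C2_pow (2 * n)"


section \<open>The group \<open>\<H>(n)\<close>\<close>

datatype gen = Xgen nat | Ygen nat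

definition gens :: "nat \<Rightarrow> gen set" where
  "gens n = Xgen ` {1..n} \<union> Ygen ` {1..n}"

definition wcomm :: "'a word \<Rightarrow> 'a word \<Rightarrow> 'a word" where
  "wcomm u v = winv u @ winv v @ u @ v"

text \<open>In \<open>relators\<close>, the sets \<open>Xw\<close> and \<open>Yw\<close> consist of the generators viewed as one-letter words.\<close>

definition relators :: "nat \<Rightarrow> gen word set" where
  "relators n =
    (let Xw = (\<lambda>i. [(Xgen i, False)]) ` {1..n};
         Yw = (\<lambda>i. [(Ygen i, False)]) ` {1..n};
         Zw = Xw \<union> Yw
     in {z @ z |z. z \<in> Zw}
      \<union> {wcomm x x' |x x'. x \<in> Xw \<and> x' \<in> Xw}
      \<union> {wcomm y y' |y y'. y \<in> Yw \<and> y' \<in> Yw}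
      \<union> {wcomm x y @ wcomm x y |x y. x \<in> Xw \<and> y \<in> Yw}
      \<union> {wcomm (wcomm y x) y' |x y y'. x \<in> Xw \<and> y \<in> Yw \<and> y' \<in> Yw}
      \<union> {wcomm (wcomm x y) z @ wcomm (wcomm x y) z |x y z. x \<in> Xw \<and> y \<in> Yw \<and> z \<in> Zw}
      \<union> {wcomm (wcomm (wcomm z z') z'') z''' |z z' z'' z'''.
            z \<in> Zw \<and> z' \<in> Zw \<and> z'' \<in> Zw \<and> z''' \<in> Zw})"

definition HH :: "nat \<Rightarrow> gen word set monoid" where
  "HH n = presented_group (gens n) (relators n)"

definition gx :: "nat \<Rightarrow> nat \<Rightarrow> gen word set" where
  "gx n i = pres_rel (gens n) (relators n) `` {[(Xgen i, False)]}"

definition gy :: "nat \<Rightarrow> nat \<Rightarrow> gen word set" where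
  "gy n i = pres_rel (gens n) (relators n) `` {[(Ygen i, False)]}"

lemma relators_words: "relators n \<subseteq> words (gens n)"
proof -
  have app: "\<And>u v. u \<in> words (gens n) \<Longrightarrow> v \<in> words (gens n) \<Longrightarrow> u @ v \<in> words (gens n)"
    by (auto simp: words_def)
  have com: "\<And>u v. u \<in> words (gens n) \<Longrightarrow> v \<in> words (gens n) \<Longrightarrow> wcomm u v \<in> words (gens n)"
    by (force simp: words_def wcomm_def winv_def)
  have letter: "[(Xgen i, False)] \<in> words (gens n)" "[(Ygen i, False)] \<in> words (gens n)"
    "[(Xgen i, False), (Xgen i, False)] \<in> words (gens n)"
    "[(Ygen i, False), (Ygen i, False)] \<in> words (gens n)" if "Suc 0 \<le> i" "i \<le> n" for i
    using that by (auto simp: words_def gens_def)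
  show ?thesis
    unfolding relators_def Let_def by (auto intro!: app com letter)
qed

lemma group_HH: "group (HH n)"
  unfolding HH_def by (rule group_presented_group[OF relators_words])

end

theory Submission
  imports Defs "HOL-Algebra.FiniteProduct" "HOL-Library.Z2"
begin

text \<open>The commutators \<open>c\<^sub>i\<^sub>j = [x\<^sub>i, y\<^sub>j]\<close> and \<open>e\<^sub>i\<^sub>j\<^sub>k = [c\<^sub>i\<^sub>j, x\<^sub>k]\<close> are pairwise commuting involutions and the
  \<open>e\<^sub>i\<^sub>j\<^sub>k\<close> are central. Collecting generators shows that all of them span the derived subgroup and that the \<open>e\<^sub>i\<^sub>j\<^sub>k\<close>
  span the third term of the lower central series; the symmetry \<open>e\<^sub>i\<^sub>j\<^sub>k = e\<^sub>k\<^sub>j\<^sub>i\<close> and \<open>e\<^sub>i\<^sub>j\<^sub>i = 1\<close> leave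
  those with \<open>i < k\<close>. Independence is detected by homomorphisms to the wreath product of \<open>C\<^sub>2\<close> by
  \<open>C\<^sub>2\<^sup>2\<close>: keep at most two of the \<open>x\<^sub>l\<close> and one of the \<open>y\<^sub>l\<close>, send the other generators to \<open>1\<close>, and read
  off one coordinate. The same characters separate the cosets in (6), where both sides become equal
  double sums over \<open>F\<^sub>2\<close>. For (5), the defining relations hold for arbitrary elements of \<open>X\<close> and \<open>Y\<close>,
  and the resulting endomorphism of the finite group is onto.\<close>

text \<open>The relations bound the group from above; what a presentation hides is whether more
  collapses. Instead of one large model with normal forms, every coordinate is detected on its own
  in a fixed group of order 64, where the relations are verified by computing with six bits. The
  shape of that group is dictated by the triple commutators: each involves two letters from
  \<open>X0\<close> and one from \<open>Y0\<close>, so two commuting involutions must act on a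
  module on which the product of their augmentations is not zero. The coordinates of the test group
  behave differently. Those of the acting group and the constant coefficient are additive everywhere
  and settle X, Y and the abelianization. The coefficients of \<open>s\<close> and of
  \<open>st\<close> are additive only where these vanish, which is the case on the image of the
  derived subgroup; characters are therefore asked to be additive on a subgroup only. That the
  double commutators commute with one another is not among the relations. It follows from writing
  such a commutator as a square of a product of two generators.\<close>

text \<open>Otherwise the simplifier replaces the field operations of \<^typ>\<open>bit\<close> by bitwise ones.\<close>

declare add_bit_eq_xor [simp del] mult_bit_eq_and [simp del]

section \<open>Commutators and groups generated by involutions\<close>

context group
begin

lemma commutator_closed [simp, intro]:
  "a \<in> carrier G \<Longrightarrow> b \<in> carrier G \<Longrightarrow> commutator G a b \<in> carrier G"
  by (simp add: commutator_def)

text \<open>The correction stands on the right, so later computations become collection: a factor is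
  moved past others and the commutators gather at the end of the word.\<close>

lemma commutator_swap:
  assumes "a \<in> carrier G" "b \<in> carrier G"
  shows "a \<otimes> b = b \<otimes> a \<otimes> commutator G a b"
proof -
  have "b \<otimes> a \<otimes> commutator G a b = b \<otimes> (a \<otimes> inv a) \<otimes> inv b \<otimes> (a \<otimes> b)"
    using assms by (simp only: commutator_def m_assoc m_closed inv_closed)
  then show ?thesis using assms by simp
qed

text \<open>Left cancellation: a commutator is found by exhibiting the factor that corrects the
  order, so no inverse has to be evaluated. Most commutator formulas in \<open>wreath\<close> are
  obtained this way.\<close>

lemma commutator_eqI:
  assumes "a \<in> carrier G" "b \<in> carrier G" "c \<in> carrier G" "a \<otimes> b = b \<otimes> a \<otimes> c"
  shows "commutator G a b = c"
  using assms commutator_swap[of a b] by (metis commutator_closed Units_eq Units_l_cancel m_closed)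

lemma commutator_eq_one_iff:
  assumes "a \<in> carrier G" "b \<in> carrier G"
  shows "commutator G a b = \<one> \<longleftrightarrow> a \<otimes> b = b \<otimes> a"
  using assms commutator_swap[of a b] commutator_eqI[of a b \<one>] by auto

lemma inv_commutator:
  assumes "a \<in> carrier G" "b \<in> carrier G"
  shows "inv (commutator G a b) = commutator G b a"
  using assms by (simp add: commutator_def inv_mult_group m_assoc)

lemma involution_inv: "a \<in> carrier G \<Longrightarrow> a \<otimes> a = \<one> \<Longrightarrow> inv a = a"
  by (rule inv_equality)

lemma involution_cancel:
  "a \<in> carrier G \<Longrightarrow> b \<in> carrier G \<Longrightarrow> a \<otimes> a = \<one> \<Longrightarrow> a \<otimes> (a \<otimes> b) = b"
  by (metis l_one m_assoc)

text \<open>Each element of \<open>S\<close> is its own inverse, so the inverse case of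
  \<open>generate\<close> falls into the case of a generator, and \<open>P\<close> need not be shown
  stable under inversion.\<close>

lemma generate_involution_induct [consumes 3, case_names one gen mult]:
  assumes "a \<in> generate G S" "S \<subseteq> carrier G" "\<forall>s\<in>S. s \<otimes> s = \<one>"
    and "P \<one>" "\<And>s. s \<in> S \<Longrightarrow> P s"
    and "\<And>a b. a \<in> carrier G \<Longrightarrow> b \<in> carrier G \<Longrightarrow> a \<in> generate G S \<Longrightarrow> b \<in> generate G S \<Longrightarrow>
      P a \<Longrightarrow> P b \<Longrightarrow> P (a \<otimes> b)"
  shows "P a"
  using assms(1)
proof induction
  case (inv h)
  then show ?case using assms(2,3,5) involution_inv[of h] by auto
next
  case (eng a b)
  then show ?case using assms(2,6) generate_in_carrier by blast
qed (use assms in auto)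

lemma generate_commute:
  assumes "S \<subseteq> carrier G" "b \<in> carrier G" "\<And>s. s \<in> S \<Longrightarrow> s \<otimes> b = b \<otimes> s" "a \<in> generate G S"
  shows "a \<otimes> b = b \<otimes> a"
  using assms(4)
proof induction
  case one
  then show ?case using assms by simp
next
  case (incl h)
  then show ?case using assms by simp
next
  case (inv h)
  then have "h \<in> carrier G" using assms by auto
  then show ?case using assms inv assms(3)[OF inv]
    by (metis inv_closed inv_solve_left inv_solve_right m_assoc m_closed)
next
  case (eng h k)
  then have "h \<in> carrier G" "k \<in> carrier G" using assms generate_in_carrier by blast+
  then show ?case using eng assms(2) by (metis m_assoc)
qed

lemma generate_commute2:
  assumes "S \<subseteq> carrier G" "T \<subseteq> carrier G" "\<And>s t. s \<in> S \<Longrightarrow> t \<in> T \<Longrightarrow> s \<otimes> t = t \<otimes> s"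
    "a \<in> generate G S" "b \<in> generate G T"
  shows "a \<otimes> b = b \<otimes> a"
proof -
  have a: "a \<in> carrier G" using assms generate_in_carrier by blast
  have "a \<otimes> t = t \<otimes> a" if "t \<in> T" for t
    using generate_commute[OF assms(1), of t a] assms that by blast
  then show ?thesis using generate_commute[OF assms(2) a _ assms(5)] by metis
qed

lemma generate_commuting_involution:
  assumes "S \<subseteq> carrier G" "\<forall>s\<in>S. s \<otimes> s = \<one>"
    "\<And>s t. s \<in> S \<Longrightarrow> t \<in> S \<Longrightarrow> s \<otimes> t = t \<otimes> s" "a \<in> generate G S"
  shows "a \<otimes> a = \<one>"
  using assms(4,1,2)
proof (induction rule: generate_involution_induct)
  case (mult a b)
  have "a \<otimes> b = b \<otimes> a" using generate_commute2[OF assms(1,1,3)] mult by blast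
  then have "(a \<otimes> b) \<otimes> (a \<otimes> b) = a \<otimes> (b \<otimes> b) \<otimes> a"
    using mult(1,2) by (metis m_assoc m_closed)
  then show ?case using mult by simp
qed (use assms in auto)

end

lemma hom_commutator:
  assumes "group G" "group K" "h \<in> hom G K" "a \<in> carrier G" "b \<in> carrier G"
  shows "h (commutator G a b) = commutator K (h a) (h b)"
proof -
  interpret group_hom G K h by (simp add: group_hom_def group_hom_axioms_def assms)
  show ?thesis using assms(4,5) by (simp add: commutator_def)
qed

section \<open>Consequences of the relations\<close>

text \<open>The relators become conditions on two subsets of an arbitrary group because they are met
  in three settings: by the generators of \<open>HH n\<close>, by their images in the test group,
  and by the images of the generators under automorphisms of the two factors. As these are sets,
  images may coincide or be trivial.\<close>

locale H_relations = group G for G (structure) +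
  fixes X0 Y0 :: "'a set"
  assumes X0_carrier: "X0 \<subseteq> carrier G" and Y0_carrier: "Y0 \<subseteq> carrier G"
    and square: "z \<in> X0 \<union> Y0 \<Longrightarrow> z \<otimes> z = \<one>"
    and comm_XX: "x \<in> X0 \<Longrightarrow> x' \<in> X0 \<Longrightarrow> commutator G x x' = \<one>"
    and comm_YY: "y \<in> Y0 \<Longrightarrow> y' \<in> Y0 \<Longrightarrow> commutator G y y' = \<one>"
    and square_comm: "x \<in> X0 \<Longrightarrow> y \<in> Y0 \<Longrightarrow> commutator G x y \<otimes> commutator G x y = \<one>"
    and comm_YXY: "x \<in> X0 \<Longrightarrow> y \<in> Y0 \<Longrightarrow> y' \<in> Y0 \<Longrightarrow> commutator G (commutator G y x) y' = \<one>"
    and square_comm_comm: "x \<in> X0 \<Longrightarrow> y \<in> Y0 \<Longrightarrow> z \<in> X0 \<union> Y0 \<Longrightarrow>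
      commutator G (commutator G x y) z \<otimes> commutator G (commutator G x y) z = \<one>"
    and class_three: "z \<in> X0 \<union> Y0 \<Longrightarrow> z' \<in> X0 \<union> Y0 \<Longrightarrow> z'' \<in> X0 \<union> Y0 \<Longrightarrow> z''' \<in> X0 \<union> Y0 \<Longrightarrow>
      commutator G (commutator G (commutator G z z') z'') z''' = \<one>"

locale H_group = H_relations +
  assumes generates: "carrier G = generate G (X0 \<union> Y0)"
begin

abbreviation comm :: "'a \<Rightarrow> 'a \<Rightarrow> 'a" where "comm \<equiv> commutator G"

definition Cset :: "'a set" where "Cset = {comm x y |x y. x \<in> X0 \<and> y \<in> Y0}"
text \<open>The last entry ranges over \<open>X0\<close> alone, since brackets of
  \<open>Cset\<close> with \<open>Y0\<close> are trivial by \<open>Cset_Y\<close>.\<close>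

definition Eset :: "'a set" where
  "Eset = {comm (comm x y) x' |x y x'. x \<in> X0 \<and> y \<in> Y0 \<and> x' \<in> X0}"
abbreviation D :: "'a set" where "D \<equiv> generate G (Cset \<union> Eset)"
abbreviation F :: "'a set" where "F \<equiv> generate G Eset"

lemma gens_carrier [simp, intro]: "z \<in> X0 \<Longrightarrow> z \<in> carrier G" "z \<in> Y0 \<Longrightarrow> z \<in> carrier G"
  using X0_carrier Y0_carrier by auto

lemma Cset_carrier: "Cset \<subseteq> carrier G" and Eset_carrier: "Eset \<subseteq> carrier G"
  unfolding Cset_def Eset_def by auto

lemma central_gens:
  assumes "a \<in> carrier G" "\<And>z. z \<in> X0 \<union> Y0 \<Longrightarrow> a \<otimes> z = z \<otimes> a" "g \<in> carrier G"
  shows "a \<otimes> g = g \<otimes> a"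
proof -
  have "g \<otimes> a = a \<otimes> g"
    by (rule generate_commute[of "X0 \<union> Y0"])
      (use assms X0_carrier Y0_carrier generates in auto)
  then show ?thesis by simp
qed

text \<open>Class three says that a bracket of weight three commutes with each generator, and this
  is enough.\<close>

lemma Eset_central: "e \<in> Eset \<Longrightarrow> g \<in> carrier G \<Longrightarrow> e \<otimes> g = g \<otimes> e"
  by (rule central_gens) (auto simp: Eset_def commutator_eq_one_iff[symmetric] class_three)

lemma F_carrier: "F \<subseteq> carrier G" and D_carrier: "D \<subseteq> carrier G"
  using generate_incl Cset_carrier Eset_carrier by auto

lemma F_subset_D: "F \<subseteq> D"
  by (rule mono_generate) auto

lemma F_central: "f \<in> F \<Longrightarrow> g \<in> carrier G \<Longrightarrow> f \<otimes> g = g \<otimes> f"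
  using generate_commute[OF Eset_carrier, of g f] Eset_central by auto

lemma Cset_X:
  assumes "c \<in> Cset" "x \<in> X0"
  obtains e where "e \<in> Eset" "c \<otimes> x = x \<otimes> c \<otimes> e"
  using assms commutator_swap[of c x] Cset_carrier unfolding Cset_def Eset_def by blast

lemma Cset_square: "c \<in> Cset \<Longrightarrow> c \<otimes> c = \<one>"
  by (auto simp: Cset_def square_comm)

lemma Eset_square: "e \<in> Eset \<Longrightarrow> e \<otimes> e = \<one>"
  by (auto simp: Eset_def square_comm_comm)

lemma comm_YX:
  assumes "x \<in> X0" "y \<in> Y0"
  shows "comm y x = comm x y"
  using assms inv_commutator[of x y] involution_inv[of "comm x y"] square_comm by auto

text \<open>The relation speaks of \<open>[y, x]\<close>; since \<open>[x, y]\<close> is an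
  involution, \<open>comm_YX\<close> identifies the two.\<close>

lemma Cset_Y: "c \<in> Cset \<Longrightarrow> y \<in> Y0 \<Longrightarrow> c \<otimes> y = y \<otimes> c"
proof -
  assume "c \<in> Cset" "y \<in> Y0"
  then obtain x y' where xy: "x \<in> X0" "y' \<in> Y0" "c = comm y' x" using comm_YX by (auto simp: Cset_def)
  then show ?thesis
    using comm_YXY[OF xy(1,2) \<open>y \<in> Y0\<close>] \<open>y \<in> Y0\<close> commutator_eq_one_iff[of c y] by auto
qed

lemma commutator_gens:
  assumes "x \<in> X0" "y \<in> Y0"
  shows "comm x y = x \<otimes> y \<otimes> x \<otimes> y"
  using assms square by (simp add: commutator_def involution_inv)

lemma F_subgroup: "subgroup F G" and D_subgroup: "subgroup D G"
  using generate_is_subgroup Cset_carrier Eset_carrier by auto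

section \<open>Commutativity and exponent two of \<open>D\<close>; its brackets with the
  group\<close>

lemma commute_mult:
  assumes "a \<in> carrier G" "b \<in> carrier G" "g \<in> carrier G" "e \<in> F" "f \<in> F"
    "a \<otimes> g = g \<otimes> a \<otimes> e" "b \<otimes> g = g \<otimes> b \<otimes> f"
  shows "(a \<otimes> b) \<otimes> g = g \<otimes> (a \<otimes> b) \<otimes> (e \<otimes> f)"
proof -
  have c: "e \<in> carrier G" "f \<in> carrier G" using assms F_carrier by auto
  have "(a \<otimes> b) \<otimes> g = a \<otimes> (g \<otimes> b \<otimes> f)" using assms(1-3,7) by (simp add: m_assoc)
  also have "\<dots> = a \<otimes> g \<otimes> b \<otimes> f" using assms(1-3) c by (simp add: m_assoc)
  also have "\<dots> = g \<otimes> a \<otimes> (e \<otimes> b) \<otimes> f" unfolding assms(6) using assms(1-3) c by (simp add: m_assoc)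
  also have "\<dots> = g \<otimes> (a \<otimes> b) \<otimes> (e \<otimes> f)" using assms c F_central[of e b] by (simp add: m_assoc)
  finally show ?thesis .
qed

text \<open>As the generators are involutions, \<open>c'\<close> is the square of \<open>xy\<close>.
  Moving \<open>c\<close> past \<open>xy\<close> costs a central involution \<open>e\<close>, so
  moving it past the square costs \<open>e\<close> twice, that is, nothing.\<close>

lemma Cset_commute: 
  assumes "c \<in> Cset" "c' \<in> Cset"
  shows "c \<otimes> c' = c' \<otimes> c"
proof -
  have c: "c \<in> carrier G" using assms Cset_carrier by auto
  obtain x y where x: "x \<in> X0" "y \<in> Y0" "c' = comm x y" using assms(2) by (auto simp: Cset_def)
  obtain e where e: "e \<in> Eset" "c \<otimes> x = x \<otimes> c \<otimes> e" using Cset_X[OF assms(1) x(1)] .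
  have ec: "e \<in> carrier G" using e Eset_carrier by auto
  have y: "c \<otimes> y = y \<otimes> c" using Cset_Y assms x by auto
  note ce = Eset_central[OF e(1)]
  have cl: "x \<in> carrier G" "y \<in> carrier G" using x by auto
  have cxy: "c \<otimes> (x \<otimes> y) = (x \<otimes> y) \<otimes> c \<otimes> e"
    using e(2) y ce[of y] cl c ec by (metis m_assoc m_closed)
  then have "c \<otimes> (x \<otimes> y \<otimes> (x \<otimes> y)) = (x \<otimes> y) \<otimes> (c \<otimes> (x \<otimes> y)) \<otimes> e"
    using ce[of "x \<otimes> y"] cl c ec by (metis m_assoc m_closed)
  also have "\<dots> = (x \<otimes> y \<otimes> (x \<otimes> y)) \<otimes> c \<otimes> (e \<otimes> e)"
    using cxy cl c ec by (simp add: m_assoc)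
  finally show ?thesis using Eset_square[OF e(1)] x cl c by (simp add: commutator_gens m_assoc)
qed

lemma CE_commute: "c \<in> Cset \<union> Eset \<Longrightarrow> c' \<in> Cset \<union> Eset \<Longrightarrow> c \<otimes> c' = c' \<otimes> c"
  using Cset_commute Eset_central Cset_carrier Eset_carrier by (metis Un_iff in_mono)

lemma D_commute: "d \<in> D \<Longrightarrow> d' \<in> D \<Longrightarrow> d \<otimes> d' = d' \<otimes> d"
  by (rule generate_commute2[of "Cset \<union> Eset" "Cset \<union> Eset"])
    (use CE_commute Cset_carrier Eset_carrier in auto)

lemma D_square: "d \<in> D \<Longrightarrow> d \<otimes> d = \<one>"
  by (rule generate_commuting_involution[of "Cset \<union> Eset"])
    (use CE_commute Cset_carrier Eset_carrier Cset_square Eset_square in auto)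

text \<open>Corrections lie in the central subgroup \<open>F\<close> and multiply by
  \<open>commute_mult\<close>. A nontrivial one can arise only from a factor in \<open>Cset\<close>
  and a letter in \<open>X0\<close>.\<close>

lemma D_swap_gen:
  assumes "d \<in> D" "z \<in> X0 \<union> Y0"
  shows "\<exists>f\<in>F. d \<otimes> z = z \<otimes> d \<otimes> f"
proof -
  have z: "z \<in> carrier G" using assms by auto
  have S: "Cset \<union> Eset \<subseteq> carrier G" using Cset_carrier Eset_carrier by auto
  have sq: "\<forall>s\<in>Cset \<union> Eset. s \<otimes> s = \<one>" using Cset_square Eset_square by auto
  have triv: "\<exists>f\<in>F. d \<otimes> z = z \<otimes> d \<otimes> f" if "d \<otimes> z = z \<otimes> d" "d \<in> carrier G" for d
    by (rule bexI[of _ \<one>]) (use that z in \<open>auto intro: generate.one\<close>)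
  show ?thesis
    using assms(1) S sq
  proof (induction rule: generate_involution_induct)
    case one
    show ?case using triv[of \<one>] z by simp
  next
    case (gen s)
    then have s: "s \<in> carrier G" using S by auto
    show ?case
    proof (cases "s \<in> Eset \<or> z \<in> Y0")
      case True
      then have "s \<otimes> z = z \<otimes> s" using s z gen Eset_central[of s z] Cset_Y[of s z] by blast
      then show ?thesis using triv s by blast
    next
      case False
      then have "s \<in> Cset" "z \<in> X0" using assms(2) gen by auto
      then obtain e where "e \<in> Eset" "s \<otimes> z = z \<otimes> s \<otimes> e" by (rule Cset_X)
      then show ?thesis using generate.incl[of e Eset G] by blast
    qed
  next
    case (mult a b)
    then obtain e f where "e \<in> F" "f \<in> F" "a \<otimes> z = z \<otimes> a \<otimes> e" "b \<otimes> z = z \<otimes> b \<otimes> f" by auto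
    then show ?case using commute_mult[of a b z e f] mult z generate.eng[of e G Eset f] by blast
  qed
qed

lemma D_swap:
  assumes "d \<in> D" "g \<in> carrier G"
  obtains f where "f \<in> F" "d \<otimes> g = g \<otimes> d \<otimes> f"
proof -
  have d: "d \<in> carrier G" using assms D_carrier by auto
  have "g \<in> generate G (X0 \<union> Y0)" using assms generates by simp
  moreover have "X0 \<union> Y0 \<subseteq> carrier G" by auto
  moreover have "\<forall>s\<in>X0 \<union> Y0. s \<otimes> s = \<one>" using square by auto
  ultimately have "\<exists>f\<in>F. d \<otimes> g = g \<otimes> d \<otimes> f"
  proof (induction rule: generate_involution_induct)
    case one
    then show ?case by (rule bexI[of _ \<one>]) (use d in \<open>auto intro: generate.one\<close>)
  next
    case (gen s)
    then show ?case using D_swap_gen[OF assms(1)] by auto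
  next
    case (mult a b)
    then obtain e f where e: "e \<in> F" "f \<in> F" "d \<otimes> a = a \<otimes> d \<otimes> e" "d \<otimes> b = b \<otimes> d \<otimes> f" by auto
    have c: "e \<in> carrier G" "f \<in> carrier G" using e F_carrier by auto
    have "d \<otimes> (a \<otimes> b) = a \<otimes> d \<otimes> (e \<otimes> b)" using e mult d c by (metis m_assoc m_closed)
    also have "\<dots> = a \<otimes> (d \<otimes> b) \<otimes> e" using F_central[OF e(1), of b] mult d c by (simp add: m_assoc)
    also have "\<dots> = (a \<otimes> b) \<otimes> d \<otimes> (f \<otimes> e)" using e(4) mult d c by (simp add: m_assoc)
    finally show ?case using generate.eng[of f G Eset e] e by blast
  qed
  then show ?thesis using that by blast
qed

lemma D_comm_F: "d \<in> D \<Longrightarrow> g \<in> carrier G \<Longrightarrow> comm d g \<in> F"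
  using D_swap[of d g] commutator_eqI[of d g] D_carrier F_carrier by (metis in_mono)

section \<open>All commutators lie in \<open>D\<close>\<close>

lemma gens_swap_gen:
  assumes "z \<in> X0 \<union> Y0" "z' \<in> X0 \<union> Y0"
  shows "\<exists>d\<in>D. z \<otimes> z' = z' \<otimes> z \<otimes> d"
proof -
  have "comm z z' \<in> Cset \<union> {\<one>}"
    using assms comm_XX[of z z'] comm_YY[of z z'] comm_YX[of z' z] unfolding Cset_def by blast
  then have "comm z z' \<in> D" using generate.one[of G "Cset \<union> Eset"] generate.incl[of "comm z z'" "Cset \<union> Eset" G] by auto
  then show ?thesis using commutator_swap[of z z'] assms by auto
qed

text \<open>Unlike in \<open>commute_mult\<close>, the first correction \<open>d\<close> need not be
  central; carrying it past \<open>b\<close> produces a factor of \<open>F\<close>, which is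
  absorbed because \<open>F\<close> lies in \<open>D\<close>.\<close>

lemma swap_mult:
  assumes g: "g \<in> carrier G" "a \<in> carrier G" "b \<in> carrier G"
    and h: "d \<in> D" "d' \<in> D" "g \<otimes> a = a \<otimes> g \<otimes> d" "g \<otimes> b = b \<otimes> g \<otimes> d'"
  shows "\<exists>d''\<in>D. g \<otimes> (a \<otimes> b) = (a \<otimes> b) \<otimes> g \<otimes> d''"
proof -
  have c: "d \<in> carrier G" "d' \<in> carrier G" using h D_carrier by auto
  obtain f where f: "f \<in> F" "d \<otimes> b = b \<otimes> d \<otimes> f" using D_swap h g by metis
  have fc: "f \<in> carrier G" using f F_carrier by auto
  have "g \<otimes> (a \<otimes> b) = a \<otimes> g \<otimes> (d \<otimes> b)" using h g c by (metis m_assoc m_closed)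
  also have "\<dots> = a \<otimes> (g \<otimes> b) \<otimes> (d \<otimes> f)" using f g c fc by (simp add: m_assoc)
  also have "\<dots> = (a \<otimes> b) \<otimes> g \<otimes> (d' \<otimes> (d \<otimes> f))" using h g c fc by (simp add: m_assoc)
  finally show ?thesis using h f F_subset_D by (blast intro: generate.eng)
qed

lemma gen_swap:
  assumes z: "z \<in> X0 \<union> Y0" and g: "g \<in> carrier G"
  shows "\<exists>d\<in>D. z \<otimes> g = g \<otimes> z \<otimes> d"
proof -
  have "g \<in> generate G (X0 \<union> Y0)" using assms generates by simp
  moreover have "X0 \<union> Y0 \<subseteq> carrier G" by auto
  moreover have "\<forall>s\<in>X0 \<union> Y0. s \<otimes> s = \<one>" using square by auto
  ultimately show ?thesis
  proof (induction rule: generate_involution_induct)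
    case one
    then show ?case by (rule bexI[of _ \<one>]) (use z in \<open>auto intro: generate.one\<close>)
  next
    case (gen s)
    then show ?case using gens_swap_gen z by auto
  next
    case (mult a b)
    then show ?case using swap_mult[of z a b] z by auto
  qed
qed

text \<open>A double induction: \<open>gen_swap\<close> builds up one argument from the generators,
  and the present induction the other. Joining them requires the relation to be symmetric.\<close>

lemma all_swap:
  assumes g: "g \<in> carrier G" and h: "h \<in> carrier G"
  shows "\<exists>d\<in>D. h \<otimes> g = g \<otimes> h \<otimes> d"
proof -
  \<comment> \<open>Since \<open>d\<close> is an involution, \<open>ab = bad\<close> can be solved
    as \<open>abd = ba\<close>.\<close>
  have sym: "\<exists>d\<in>D. b \<otimes> a = a \<otimes> b \<otimes> d" if ab: "\<exists>d\<in>D. a \<otimes> b = b \<otimes> a \<otimes> d" "a \<in> carrier G" "b \<in> carrier G" for a b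
  proof -
    obtain d where d: "d \<in> D" "a \<otimes> b = b \<otimes> a \<otimes> d" using ab by blast
    have "d \<in> carrier G" using d D_carrier by auto
    then have "a \<otimes> b \<otimes> d = b \<otimes> a" using d D_square[OF d(1)] ab by (simp add: m_assoc)
    then show ?thesis using d by metis
  qed
  have "g \<in> generate G (X0 \<union> Y0)" using assms generates by simp
  moreover have "X0 \<union> Y0 \<subseteq> carrier G" by auto
  moreover have "\<forall>s\<in>X0 \<union> Y0. s \<otimes> s = \<one>" using square by auto
  ultimately show ?thesis
  proof (induction rule: generate_involution_induct)
    case one
    then show ?case by (rule bexI[of _ \<one>]) (use h in \<open>auto intro: generate.one\<close>)
  next
    case (gen s)
    then show ?case using gen_swap[of s h] sym[of s h] h by auto
  next
    case (mult a b)
    then show ?case using swap_mult[of h a b] h by auto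
  qed
qed

lemma comm_in_D:
  assumes "g \<in> carrier G" "h \<in> carrier G"
  shows "comm g h \<in> D"
proof -
  obtain d where d: "d \<in> D" "g \<otimes> h = h \<otimes> g \<otimes> d" using all_swap assms by blast
  then show ?thesis using commutator_eqI[of g h d] assms D_carrier by auto
qed

lemma derived_eq: "derived G (carrier G) = D"
proof
  \<comment> \<open>The element \<open>ghg^-1h^-1\<close> is the bracket of the two inverses in the
    convention used here.\<close>
  have "g \<otimes> h \<otimes> inv g \<otimes> inv h \<in> D" if "g \<in> carrier G" "h \<in> carrier G" for g h
    using comm_in_D[of "inv g" "inv h"] that by (simp add: commutator_def)
  then show "derived G (carrier G) \<subseteq> D"
    unfolding derived_def by (intro generate_subgroup_incl[OF _ D_subgroup]) auto
  have com: "comm g h \<in> derived G (carrier G)" if "g \<in> carrier G" "h \<in> carrier G" for g h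
  proof -
    have "inv g \<otimes> inv h \<otimes> inv (inv g) \<otimes> inv (inv h) \<in> derived_set G (carrier G)"
      by (rule UN_I[of "inv g"], use that in simp, rule UN_I[of "inv h"], use that in simp, rule singletonI)
    then have "inv g \<otimes> inv h \<otimes> inv (inv g) \<otimes> inv (inv h) \<in> derived G (carrier G)"
      unfolding derived_def by (rule generate.incl)
    then show ?thesis using that unfolding commutator_def by simp
  qed
  show "D \<subseteq> derived G (carrier G)"
    by (rule generate_subgroup_incl[OF _ derived_is_subgroup])
      (auto simp: Cset_def Eset_def intro!: com)
qed

lemma lower_central_3_eq: "lower_central_3 G = F"
proof
  show "lower_central_3 G \<subseteq> F"
    unfolding lower_central_3_def commutator_subgroup_def derived_eq
    by (rule generate_subgroup_incl[OF _ F_subgroup]) (auto intro: D_comm_F)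
  have "Eset \<subseteq> {comm d g |d g. d \<in> D \<and> g \<in> carrier G}"
  proof
    fix e assume "e \<in> Eset"
    then obtain x y x' where e: "e = comm (comm x y) x'" "x \<in> X0" "y \<in> Y0" "x' \<in> X0"
      by (auto simp: Eset_def)
    then have "comm x y \<in> D" "x' \<in> carrier G" using comm_in_D[of x y] by auto
    then show "e \<in> {comm d g |d g. d \<in> D \<and> g \<in> carrier G}" using e(1) by blast
  qed
  then show "F \<subseteq> lower_central_3 G"
    unfolding lower_central_3_def commutator_subgroup_def derived_eq by (rule mono_generate)
qed

text \<open>For involutions \<open>[x, y]\<close> is \<open>xyxy\<close> and, being equal to its
  inverse, also \<open>yxyx\<close>. Multiplying the second form by \<open>x\<close> on the right,
  or the first by \<open>x\<close> on the left, leaves \<open>yxy\<close>.\<close>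

lemma comm_comm_self:
  assumes "x \<in> X0" "y \<in> Y0"
  shows "comm (comm x y) x = \<one>"
proof -
  have c: "x \<in> carrier G" "y \<in> carrier G" using assms by auto
  have s: "x \<otimes> x = \<one>" using square assms by auto
  have "comm x y = y \<otimes> x \<otimes> y \<otimes> x"
    using assms square comm_YX[OF assms] by (simp add: commutator_def involution_inv)
  then have "comm x y \<otimes> x = y \<otimes> x \<otimes> y" using c s by (simp add: m_assoc)
  moreover have "x \<otimes> comm x y = y \<otimes> x \<otimes> y"
    using commutator_gens[OF assms] c s involution_cancel[of x] by (simp add: m_assoc)
  ultimately show ?thesis using c by (simp add: commutator_eq_one_iff)
qed

lemma X_commute: "x \<in> X0 \<Longrightarrow> x' \<in> X0 \<Longrightarrow> x \<otimes> x' = x' \<otimes> x"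
  and Y_commute: "y \<in> Y0 \<Longrightarrow> y' \<in> Y0 \<Longrightarrow> y \<otimes> y' = y' \<otimes> y"
  using comm_XX comm_YY commutator_eq_one_iff by auto

text \<open>Both sides expand \<open>[xx', y] = [x, y]\<^sup>x\<^sup>' [x', y] = [x', y]\<^sup>x [x, y]\<close>.\<close>

lemma comm_comm_swap:
  assumes "x \<in> X0" "x' \<in> X0" "y \<in> Y0"
  shows "comm (comm x y) x' = comm (comm x' y) x"
proof -
  define c c' where "c = comm x y" and "c' = comm x' y"
  have cl: "x \<in> carrier G" "x' \<in> carrier G" "y \<in> carrier G" "c \<in> carrier G" "c' \<in> carrier G"
    using assms by (auto simp: c_def c'_def)
  have s: "x \<otimes> x = \<one>" "x' \<otimes> x' = \<one>" "y \<otimes> y = \<one>" using square assms by auto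
  have D: "c \<in> D" "c' \<in> D" using cl comm_in_D by (auto simp: c_def c'_def)
  have sc: "c \<otimes> c = \<one>" "c' \<otimes> c' = \<one>" using D_square D by auto
  note canc = involution_cancel[OF _ _ s(1)] involution_cancel[OF _ _ s(2)] involution_cancel[OF _ _ s(3)]
    involution_cancel[OF _ _ sc(1)] involution_cancel[OF _ _ sc(2)]
  have e: "comm c x' = c \<otimes> (x' \<otimes> c \<otimes> x')" "comm c' x = c' \<otimes> (x \<otimes> c' \<otimes> x)"
    using cl s sc by (simp_all add: commutator_def involution_inv m_assoc)
  have eD: "comm c x' \<in> D" "comm c' x \<in> D" using cl comm_in_D by auto
  have conj: "x' \<otimes> c \<otimes> x' = c \<otimes> comm c x'" "x \<otimes> c' \<otimes> x = c' \<otimes> comm c' x"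
    using e cl canc by auto
  have XX: "x \<otimes> x' = x' \<otimes> x" using X_commute assms by auto
  have "(x' \<otimes> c \<otimes> x') \<otimes> c' = x' \<otimes> x \<otimes> y \<otimes> (x \<otimes> x') \<otimes> y"
    using cl canc s commutator_gens[OF assms(1,3)] commutator_gens[OF assms(2,3)]
    by (simp add: c_def c'_def m_assoc)
  moreover have "(x \<otimes> c' \<otimes> x) \<otimes> c = x \<otimes> x' \<otimes> y \<otimes> (x' \<otimes> x) \<otimes> y"
    using cl canc s commutator_gens[OF assms(1,3)] commutator_gens[OF assms(2,3)]
    by (simp add: c_def c'_def m_assoc)
  ultimately have "(x' \<otimes> c \<otimes> x') \<otimes> c' = (x \<otimes> c' \<otimes> x) \<otimes> c" using XX by simp
  then have "c \<otimes> comm c x' \<otimes> c' = c' \<otimes> comm c' x \<otimes> c" using conj by simp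
  moreover have "c \<otimes> comm c x' \<otimes> c' = c \<otimes> c' \<otimes> comm c x'"
    using D_commute[OF eD(1) D(2)] cl by (simp add: m_assoc)
  moreover have "c' \<otimes> comm c' x \<otimes> c = c' \<otimes> c \<otimes> comm c' x"
    using D_commute[OF eD(2) D(1)] cl by (simp add: m_assoc)
  ultimately have "(c \<otimes> c') \<otimes> comm c x' = (c \<otimes> c') \<otimes> comm c' x" using D_commute[OF D] by simp
  then show ?thesis using cl unfolding c_def c'_def by simp
qed

text \<open>On generators this is \<open>Cset_Y\<close> and the centrality of \<open>Eset\<close>.
  Since all commutators lie in \<open>D\<close>, it is the substance of (4).\<close>

lemma D_Y:
  assumes "d \<in> D" "b \<in> generate G Y0"
  shows "d \<otimes> b = b \<otimes> d"
proof (rule generate_commute2[OF _ Y0_carrier _ assms])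
  show "Cset \<union> Eset \<subseteq> carrier G" using Cset_carrier Eset_carrier by auto
  show "s \<otimes> t = t \<otimes> s" if "s \<in> Cset \<union> Eset" "t \<in> Y0" for s t
    using that Cset_Y[of s t] Eset_central[of s t] by auto
qed

text \<open>Once \<open>D\<close> is known to be abelian of exponent two, to commute with the span
  of \<open>Y0\<close> and to have central brackets, the relations pass to arbitrary elements of the
  two spans. An automorphism of a factor sends a generator to just such an element.\<close>

lemma H_relations_subset:
  assumes "A \<subseteq> generate G X0" "B \<subseteq> generate G Y0"
  shows "H_relations G A B"
proof
  have X: "A \<subseteq> carrier G" using assms(1) generate_incl[OF X0_carrier] by auto
  have Y: "B \<subseteq> carrier G" using assms(2) generate_incl[OF Y0_carrier] by auto
  show "A \<subseteq> carrier G" "B \<subseteq> carrier G" by fact+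
  have AB: "z \<in> carrier G" if "z \<in> A \<union> B" for z using X Y that by auto
  note cl = X[THEN subsetD] Y[THEN subsetD]
  show "z \<otimes> z = \<one>" if "z \<in> A \<union> B" for z
    using that generate_commuting_involution[OF X0_carrier _ X_commute]
      generate_commuting_involution[OF Y0_carrier _ Y_commute] assms square by blast
  show "comm x x' = \<one>" if "x \<in> A" "x' \<in> A" for x x'
    using that generate_commute2[OF X0_carrier X0_carrier X_commute] assms(1)
    by (subst commutator_eq_one_iff) (auto simp: cl)
  show "comm x x' = \<one>" if "x \<in> B" "x' \<in> B" for x x'
    using that generate_commute2[OF Y0_carrier Y0_carrier Y_commute] assms(2)
    by (subst commutator_eq_one_iff) (auto simp: cl)
  show "comm x y \<otimes> comm x y = \<one>" if "x \<in> A" "y \<in> B" for x y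
    using that cl by (auto intro: D_square comm_in_D)
  show "comm (comm x y) z \<otimes> comm (comm x y) z = \<one>" if "x \<in> A" "y \<in> B" "z \<in> A \<union> B" for x y z
    using that cl AB by (auto intro!: D_square comm_in_D)
  show "comm (comm y x) y' = \<one>" if "x \<in> A" "y \<in> B" "y' \<in> B" for x y y'
    using that cl assms(2) by (subst commutator_eq_one_iff) (auto intro!: D_Y comm_in_D)
  show "comm (comm (comm z z') z'') z''' = \<one>"
    if "z \<in> A \<union> B" "z' \<in> A \<union> B" "z'' \<in> A \<union> B" "z''' \<in> A \<union> B" for z z' z'' z'''
    using that[THEN AB] by (subst commutator_eq_one_iff) (auto intro!: F_central D_comm_F comm_in_D)
qed

end

section \<open>Homomorphisms out of a presented group\<close>

definition weval :: "('b, 'c) monoid_scheme \<Rightarrow> ('a \<Rightarrow> 'b) \<Rightarrow> 'a word \<Rightarrow> 'b" where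
  "weval K \<phi> w = foldr (\<lambda>(a, e) r. (if e then inv\<^bsub>K\<^esub> \<phi> a else \<phi> a) \<otimes>\<^bsub>K\<^esub> r) w \<one>\<^bsub>K\<^esub>"

lemma weval_Nil [simp]: "weval K \<phi> [] = \<one>\<^bsub>K\<^esub>"
  and weval_Cons [simp]:
    "weval K \<phi> ((a, e) # w) = (if e then inv\<^bsub>K\<^esub> \<phi> a else \<phi> a) \<otimes>\<^bsub>K\<^esub> weval K \<phi> w"
  by (simp_all add: weval_def)

lemma words_Nil [simp]: "[] \<in> words S"
  and words_Cons [simp]: "p # w \<in> words S \<longleftrightarrow> fst p \<in> S \<and> w \<in> words S"
  and words_append [simp]: "u @ v \<in> words S \<longleftrightarrow> u \<in> words S \<and> v \<in> words S"
  and words_winv [simp]: "winv u \<in> words S \<longleftrightarrow> u \<in> words S"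
  by (force simp: words_def winv_def)+

lemma words_wcomm [simp]: "wcomm u v \<in> words S \<longleftrightarrow> u \<in> words S \<and> v \<in> words S"
  by (auto simp: wcomm_def)

context group
begin

context
  fixes \<phi> :: "'g \<Rightarrow> 'a" and S :: "'g set"
  assumes \<phi>: "\<phi> \<in> S \<rightarrow> carrier G"
begin

lemma weval_closed [simp]: "w \<in> words S \<Longrightarrow> weval G \<phi> w \<in> carrier G"
  using \<phi> by (induction w) (auto simp: Pi_iff)

lemma weval_append:
  "u \<in> words S \<Longrightarrow> v \<in> words S \<Longrightarrow> weval G \<phi> (u @ v) = weval G \<phi> u \<otimes> weval G \<phi> v"
  using \<phi> by (induction u) (auto simp: m_assoc Pi_iff)

lemma weval_winv: "u \<in> words S \<Longrightarrow> weval G \<phi> (winv u) = inv (weval G \<phi> u)"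
proof (induction u)
  case Nil
  then show ?case by (simp add: winv_def)
next
  case (Cons p u)
  obtain a e where p: "p = (a, e)" by force
  have a: "\<phi> a \<in> carrier G" using Cons.prems p \<phi> by auto
  have "winv (p # u) = winv u @ [(a, \<not> e)]" by (simp add: winv_def p)
  then show ?case using Cons p a by (auto simp: weval_append inv_mult_group)
qed

lemma weval_wcomm:
  "u \<in> words S \<Longrightarrow> v \<in> words S \<Longrightarrow>
    weval G \<phi> (wcomm u v) = commutator G (weval G \<phi> u) (weval G \<phi> v)"
  by (simp add: wcomm_def commutator_def weval_append weval_winv m_assoc)

lemma weval_pres_eq:
  assumes R: "R \<subseteq> words S" "\<And>r. r \<in> R \<Longrightarrow> weval G \<phi> r = \<one>" and "pres_eq S R u v"
  shows "weval G \<phi> u = weval G \<phi> v"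
  using assms(3)
proof induction
  case (cancel a e)
  then have "\<phi> a \<in> carrier G" using \<phi> by auto
  then show ?case by simp
next
  case (append u u' v v')
  then show ?case using pres_eq_words[OF R(1)] by (simp add: weval_append)
qed (use R in auto)

end

end

lemma carrier_presented_group:
  "carrier (presented_group S R) = (\<lambda>u. pres_rel S R `` {u}) ` words S"
  by (auto simp: presented_group_def quotient_def)

text \<open>Von Dyck's theorem, by evaluating words: evaluation is constant on classes because it
  respects both cancellation and relators.\<close>

lemma presented_group_universal:
  fixes K :: "('b, 'c) monoid_scheme"
  assumes "group K" "\<phi> \<in> S \<rightarrow> carrier K" "R \<subseteq> words S" "\<And>r. r \<in> R \<Longrightarrow> weval K \<phi> r = \<one>\<^bsub>K\<^esub>"
  obtains h where "h \<in> hom (presented_group S R) K"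
    "\<And>a. a \<in> S \<Longrightarrow> h (pres_rel S R `` {[(a, False)]}) = \<phi> a"
proof -
  interpret K: group K by fact
  \<comment> \<open>A class is evaluated at an arbitrary representative;
    \<open>weval_pres_eq\<close> makes the choice irrelevant.\<close>
  define h where "h A = weval K \<phi> (SOME w. w \<in> A)" for A
  have h: "h (pres_rel S R `` {u}) = weval K \<phi> u" if "u \<in> words S" for u
  proof -
    have "u \<in> pres_rel S R `` {u}" using that by (auto simp: pres_rel_def intro: pres_eq.refl)
    then have "(SOME w. w \<in> pres_rel S R `` {u}) \<in> pres_rel S R `` {u}" by (rule someI)
    then show ?thesis
      using K.weval_pres_eq[OF assms(2-4)] unfolding h_def by (auto simp: pres_rel_def)
  qed
  show thesis
  proof
    show "h \<in> hom (presented_group S R) K"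
      by (rule homI)
        (auto simp: carrier_presented_group h K.weval_closed[OF assms(2)]
          presented_group_mult[OF assms(3)] K.weval_append[OF assms(2)])
    show "h (pres_rel S R `` {[(a, False)]}) = \<phi> a" if "a \<in> S" for a
      using that assms(2) K.r_one by (subst h) (auto simp: Pi_iff)
  qed
qed

text \<open>Induction along the word, where the class of an inverse letter is the inverse class by
  \<open>cancel\<close>. This turns relators into equations between the generators, and shows that
  the generators generate.\<close>

lemma presented_class_weval:
  assumes "R \<subseteq> words S" "w \<in> words S"
  shows "pres_rel S R `` {w} = weval (presented_group S R) (\<lambda>a. pres_rel S R `` {[(a, False)]}) w"
proof -
  let ?P = "presented_group S R" and ?c = "\<lambda>w. pres_rel S R `` {w}"
  interpret P: group ?P by (rule group_presented_group[OF assms(1)])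
  show ?thesis
    using assms(2)
  proof (induction w)
    case Nil
    then show ?case by (simp add: presented_group_def)
  next
    case (Cons p w)
    obtain a e where p: "p = (a, e)" by force
    have a: "a \<in> S" "w \<in> words S" using Cons.prems p by auto
    have inv: "?c [(a, True)] = inv\<^bsub>?P\<^esub> ?c [(a, False)]"
    proof (rule P.inv_equality[symmetric])
      have "(([(a, True), (a, False)], []) :: 'a word \<times> 'a word) \<in> pres_rel S R"
        using pres_eq.cancel[OF a(1), of R True] by (simp add: pres_rel_def)
      then have "?c [(a, True), (a, False)] = ?c []"
        using equiv_class_eq[OF equiv_pres_rel[OF assms(1)]] by metis
      then show "?c [(a, True)] \<otimes>\<^bsub>?P\<^esub> ?c [(a, False)] = \<one>\<^bsub>?P\<^esub>"
        using a presented_group_mult[OF assms(1), of "[(a, True)]" "[(a, False)]"]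
        by (simp add: presented_group_def)
    qed (use a in \<open>auto simp: carrier_presented_group\<close>)
    have "?c (p # w) = ?c [(a, e)] \<otimes>\<^bsub>?P\<^esub> ?c w"
      using a p presented_group_mult[OF assms(1), of "[(a, e)]" w] by simp
    then show ?case using p Cons.IH[OF a(2)] inv by auto
  qed
qed

lemma presented_group_generated:
  assumes "R \<subseteq> words S"
  shows "carrier (presented_group S R) =
    generate (presented_group S R) ((\<lambda>a. pres_rel S R `` {[(a, False)]}) ` S)" (is "_ = generate ?P ?L")
proof
  interpret P: group ?P by (rule group_presented_group[OF assms])
  have gen: "pres_rel S R `` {[(a, False)]} \<in> generate ?P ?L"
      "inv\<^bsub>?P\<^esub> (pres_rel S R `` {[(a, False)]}) \<in> generate ?P ?L" if "a \<in> S" for a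
    using that by (auto intro: generate.incl generate.inv)
  have weval: "weval ?P (\<lambda>a. pres_rel S R `` {[(a, False)]}) w \<in> generate ?P ?L" if "w \<in> words S" for w
    using that
  proof (induction w)
    case Nil
    show ?case by (simp add: generate.one)
  next
    case (Cons p w)
    obtain a e where p: "p = (a, e)" by force
    then have "a \<in> S" "w \<in> words S" using Cons.prems by auto
    then show ?case unfolding p weval_Cons using Cons.IH gen by (intro generate.eng) auto
  qed
  show "carrier ?P \<subseteq> generate ?P ?L"
    unfolding carrier_presented_group 
  proof (rule image_subsetI)
    fix w assume w: "w \<in> words S"
    show "pres_rel S R `` {w} \<in> generate ?P ?L"
      unfolding presented_class_weval[OF assms w] by (rule weval[OF w])
  qed
  show "generate ?P ?L \<subseteq> carrier ?P"
    by (rule P.generate_incl) (auto simp: carrier_presented_group)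
qed

text \<open>Evaluation sends formal squares and commutators to actual ones. Both directions matter:
  one makes the relations available in \<open>HH n\<close>, the other provides homomorphisms out of
  it.\<close>

lemma relators_weval_iff:
  assumes "group K" "u \<in> {1..n} \<rightarrow> carrier K" "v \<in> {1..n} \<rightarrow> carrier K"
  shows "(\<forall>r\<in>relators n. weval K (case_gen u v) r = \<one>\<^bsub>K\<^esub>) \<longleftrightarrow> H_relations K (u ` {1..n}) (v ` {1..n})"
proof -
  interpret group K by fact
  have \<phi>: "case_gen u v \<in> gens n \<rightarrow> carrier K"
    using assms by (auto simp: gens_def)
  define X where "X = (\<lambda>i. [(Xgen i, False)]) ` {1..n}"
  define Y where "Y = (\<lambda>i. [(Ygen i, False)]) ` {1..n}"
  define e where "e = weval K (case_gen u v)"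
  have w: "X \<subseteq> words (gens n)" "Y \<subseteq> words (gens n)" "X \<union> Y \<subseteq> words (gens n)"
    by (auto simp: X_def Y_def gens_def)
  have XY: "u ` {1..n} = e ` X" "v ` {1..n} = e ` Y"
    using assms(2,3) by (auto simp: X_def Y_def image_image Pi_iff e_def)
  note w' [simp] = w[THEN subsetD]
  have c: "e ` X \<subseteq> carrier K" "e ` Y \<subseteq> carrier K"
    using weval_closed[OF \<phi>] by (auto simp: e_def)
  have ev: "e (z @ z') = e z \<otimes>\<^bsub>K\<^esub> e z'" "e (wcomm z z') = commutator K (e z) (e z')"
    if "z \<in> words (gens n)" "z' \<in> words (gens n)" for z z'
    using weval_append[OF \<phi>] weval_wcomm[OF \<phi>] that by (auto simp: e_def)
  have rel: "relators n = {z @ z |z. z \<in> X \<union> Y}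
      \<union> {wcomm x x' |x x'. x \<in> X \<and> x' \<in> X}
      \<union> {wcomm y y' |y y'. y \<in> Y \<and> y' \<in> Y}
      \<union> {wcomm x y @ wcomm x y |x y. x \<in> X \<and> y \<in> Y}
      \<union> {wcomm (wcomm y x) y' |x y y'. x \<in> X \<and> y \<in> Y \<and> y' \<in> Y}
      \<union> {wcomm (wcomm x y) z @ wcomm (wcomm x y) z |x y z. x \<in> X \<and> y \<in> Y \<and> z \<in> X \<union> Y}
      \<union> {wcomm (wcomm (wcomm z z') z'') z''' |z z' z'' z'''.
            z \<in> X \<union> Y \<and> z' \<in> X \<union> Y \<and> z'' \<in> X \<union> Y \<and> z''' \<in> X \<union> Y}"
    by (simp only: relators_def Let_def X_def Y_def)
  have Z: "e ` X \<union> e ` Y = e ` (X \<union> Y)"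
    by blast
  \<comment> \<open>Kept as an atom, the union does not split every letter into two cases; the
    class-three relator would have sixteen.\<close>
  define U where "U = X \<union> Y"
  have U [simp]: "z \<in> words (gens n)" if "z \<in> U" for z using w that by (auto simp: U_def)
  have mem: "z @ z \<in> relators n" if "z \<in> U" for z
    using that unfolding rel U_def by blast
  have memXX: "wcomm x x' \<in> relators n" if "x \<in> X" "x' \<in> X" for x x'
    using that unfolding rel by blast
  have memYY: "wcomm x x' \<in> relators n" if "x \<in> Y" "x' \<in> Y" for x x'
    using that unfolding rel by blast
  have memXY: "wcomm x y @ wcomm x y \<in> relators n" if "x \<in> X" "y \<in> Y" for x y
    using that unfolding rel by blast
  have memYXY: "wcomm (wcomm y x) y' \<in> relators n" if "x \<in> X" "y \<in> Y" "y' \<in> Y" for x y y'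
    using that unfolding rel by blast
  have memXYZ: "wcomm (wcomm x y) z @ wcomm (wcomm x y) z \<in> relators n"
    if "x \<in> X" "y \<in> Y" "z \<in> U" for x y z
    using that unfolding rel U_def by blast
  have memZ: "wcomm (wcomm (wcomm z z') z'') z''' \<in> relators n"
    if "z \<in> U" "z' \<in> U" "z'' \<in> U" "z''' \<in> U" for z z' z'' z'''
    using that unfolding rel U_def by blast
  show ?thesis
    unfolding e_def[symmetric]
  proof
    assume R: "\<forall>r\<in>relators n. e r = \<one>\<^bsub>K\<^esub>"
    note R' = R[THEN bspec, OF mem] R[THEN bspec, OF memXX] R[THEN bspec, OF memYY]
      R[THEN bspec, OF memXY] R[THEN bspec, OF memYXY] R[THEN bspec, OF memXYZ] R[THEN bspec, OF memZ]
    show "H_relations K (u ` {1..n}) (v ` {1..n})"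
      unfolding H_relations_def H_relations_axioms_def XY Z U_def[symmetric]
      using assms(1) c R' by (auto simp: ev)
  next
    assume "H_relations K (u ` {1..n}) (v ` {1..n})"
    then show "\<forall>r\<in>relators n. e r = \<one>\<^bsub>K\<^esub>"
      unfolding H_relations_def H_relations_axioms_def XY Z rel U_def[symmetric]
      by (auto simp: ball_Un ev)
  qed
qed

lemma HH_generated:
  "carrier (HH n) = generate (HH n) (gx n ` {1..n} \<union> gy n ` {1..n})"
proof -
  have "(\<lambda>a. pres_rel (gens n) (relators n) `` {[(a, False)]}) ` gens n = gx n ` {1..n} \<union> gy n ` {1..n}"
    by (simp add: gx_def gy_def gens_def image_Un image_image)
  then show ?thesis
    unfolding HH_def using presented_group_generated[OF relators_words[of n]] by simp
qed

lemma gx_closed [simp]: "i \<in> {1..n} \<Longrightarrow> gx n i \<in> carrier (HH n)"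
  and gy_closed [simp]: "i \<in> {1..n} \<Longrightarrow> gy n i \<in> carrier (HH n)"
  by (auto simp: HH_def gx_def gy_def carrier_presented_group gens_def)

lemma H_group_HH: "H_group (HH n) (gx n ` {1..n}) (gy n ` {1..n})"
proof -
  let ?L = "\<lambda>a. pres_rel (gens n) (relators n) `` {[(a, False)]}"
  have L: "case_gen (gx n) (gy n) = ?L" by (auto simp: fun_eq_iff gx_def gy_def split: gen.splits)
  have "weval (HH n) ?L r = \<one>\<^bsub>HH n\<^esub>" if "r \<in> relators n" for r
  proof -
    have "pres_rel (gens n) (relators n) `` {r} = pres_rel (gens n) (relators n) `` {[]}"
      by (rule equiv_class_eq[OF equiv_pres_rel[OF relators_words]])
        (use pres_eq.relator[OF that] in \<open>auto simp: pres_rel_def\<close>)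
    moreover have "pres_rel (gens n) (relators n) `` {r} = weval (HH n) ?L r"
      unfolding HH_def by (rule presented_class_weval) (use relators_words that in auto)
    ultimately show ?thesis by (simp add: HH_def presented_group_def)
  qed
  then have "H_relations (HH n) (gx n ` {1..n}) (gy n ` {1..n})"
    using relators_weval_iff[OF group_HH[of n], where u = "gx n" and v = "gy n" and n = n] unfolding L by (auto simp: Pi_iff)
  then show ?thesis
    using HH_generated by (simp add: H_group_def H_group_axioms_def)
qed

lemma HH_universal:
  assumes "group K" "u \<in> {1..n} \<rightarrow> carrier K" "v \<in> {1..n} \<rightarrow> carrier K"
    and "H_relations K (u ` {1..n}) (v ` {1..n})"
  obtains h where "h \<in> hom (HH n) K" "\<And>i. i \<in> {1..n} \<Longrightarrow> h (gx n i) = u i"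
    "\<And>i. i \<in> {1..n} \<Longrightarrow> h (gy n i) = v i"
proof -
  have "case_gen u v \<in> gens n \<rightarrow> carrier K" using assms(2,3) by (auto simp: gens_def)
  moreover have "weval K (case_gen u v) r = \<one>\<^bsub>K\<^esub>" if "r \<in> relators n" for r
    using relators_weval_iff[OF assms(1-3)] assms(4) that by blast
  ultimately obtain h where h: "h \<in> hom (presented_group (gens n) (relators n)) K"
    "\<And>a. a \<in> gens n \<Longrightarrow> h (pres_rel (gens n) (relators n) `` {[(a, False)]}) = case_gen u v a"
    using presented_group_universal[OF assms(1) _ relators_words] by blast
  show thesis
  proof
    show "h \<in> hom (HH n) K" using h(1) by (simp add: HH_def)
  qed (use h(2) in \<open>auto simp: gx_def gy_def gens_def\<close>)
qed

section \<open>Elementary abelian 2-groups with a dual basis of characters\<close>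

lemma (in comm_group) finprod_char:
  fixes \<chi> :: "'a \<Rightarrow> bit"
  assumes "finite I" "f \<in> I \<rightarrow> carrier G"
    and "\<And>a b. a \<in> carrier G \<Longrightarrow> b \<in> carrier G \<Longrightarrow> \<chi> (a \<otimes> b) = \<chi> a + \<chi> b"
  shows "\<chi> (finprod G f I) = (\<Sum>i\<in>I. \<chi> (f i))"
proof -
  have "\<chi> \<one> = \<chi> \<one> + \<chi> \<one>" using assms(3)[of \<one> \<one>] by simp
  then have "\<chi> \<one> = 0" by (cases "\<chi> \<one>") auto
  show ?thesis using assms(1,2)
    by (induction I rule: finite_induct) (auto simp: assms(3) \<open>\<chi> \<one> = 0\<close>)
qed

text \<open>The product on the right is multiplicative in \<open>a\<close>, since exponents add
  modulo 2 and each \<open>g i\<close> squares to one. It is thus enough to compare on generators,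
  where duality leaves a single factor.\<close>

lemma (in comm_group) dual_basis_expansion:
  fixes \<chi> :: "'i \<Rightarrow> 'a \<Rightarrow> bit"
  assumes fin: "finite I" and g: "g \<in> I \<rightarrow> carrier G" "\<And>i. i \<in> I \<Longrightarrow> g i \<otimes> g i = \<one>"
    and gen: "carrier G = generate G (g ` I)"
    and char: "\<And>i a b. i \<in> I \<Longrightarrow> a \<in> carrier G \<Longrightarrow> b \<in> carrier G \<Longrightarrow> \<chi> i (a \<otimes> b) = \<chi> i a + \<chi> i b"
    and dual: "\<And>i j. i \<in> I \<Longrightarrow> j \<in> I \<Longrightarrow> \<chi> i (g j) = of_bool (i = j)"
    and a: "a \<in> carrier G"
  shows "a = (\<Otimes>i\<in>I. if \<chi> i a = 1 then g i else \<one>)"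
proof -
  have one: "\<chi> i \<one> = 0" if "i \<in> I" for i
    using char[OF that, of \<one> \<one>] by (cases "\<chi> i \<one>") auto
  have "a \<in> generate G (g ` I)" "g ` I \<subseteq> carrier G" "\<forall>s\<in>g ` I. s \<otimes> s = \<one>"
    using a g gen by auto
  then show ?thesis
  proof (induction rule: generate_involution_induct)
    case one
    then show ?case using \<open>\<And>i. i \<in> I \<Longrightarrow> \<chi> i \<one> = 0\<close>
      by (simp add: finprod_one_eqI)
  next
    case (gen s)
    then obtain j where j: "j \<in> I" "s = g j" by auto
    have "(\<Otimes>i\<in>I. if \<chi> i s = 1 then g i else \<one>) = (\<Otimes>i\<in>I. if j = i then g i else \<one>)"
      by (rule finprod_cong') (use g j dual in auto)
    also have "\<dots> = g j" using finprod_singleton[OF j(1) fin] g by auto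
    finally show ?case using j by simp
  next
    case (mult a b)
    have "(\<Otimes>i\<in>I. if \<chi> i (a \<otimes> b) = 1 then g i else \<one>) =
        (\<Otimes>i\<in>I. (if \<chi> i a = 1 then g i else \<one>) \<otimes> (if \<chi> i b = 1 then g i else \<one>))"
      by (rule finprod_cong') (use g mult char in \<open>auto simp: Pi_iff\<close>)
    also have "\<dots> = (\<Otimes>i\<in>I. if \<chi> i a = 1 then g i else \<one>) \<otimes> (\<Otimes>i\<in>I. if \<chi> i b = 1 then g i else \<one>)"
      by (rule finprod_multf) (use g in auto)
    finally show ?case using mult by simp
  qed
qed

lemma (in comm_group) dual_basis_inj:
  fixes \<chi> :: "'i \<Rightarrow> 'a \<Rightarrow> bit"
  assumes "finite I" "g \<in> I \<rightarrow> carrier G" "\<And>i. i \<in> I \<Longrightarrow> g i \<otimes> g i = \<one>"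
    and "carrier G = generate G (g ` I)"
    and "\<And>i a b. i \<in> I \<Longrightarrow> a \<in> carrier G \<Longrightarrow> b \<in> carrier G \<Longrightarrow> \<chi> i (a \<otimes> b) = \<chi> i a + \<chi> i b"
    and "\<And>i j. i \<in> I \<Longrightarrow> j \<in> I \<Longrightarrow> \<chi> i (g j) = of_bool (i = j)"
    and ab: "a \<in> carrier G" "b \<in> carrier G" "\<And>i. i \<in> I \<Longrightarrow> \<chi> i a = \<chi> i b"
  shows "a = b"
proof -
  have "(\<Otimes>i\<in>I. if \<chi> i a = 1 then g i else \<one>) = (\<Otimes>i\<in>I. if \<chi> i b = 1 then g i else \<one>)"
    by (rule finprod_cong') (use assms(2) ab(3) in auto)
  from HOL.trans[OF HOL.trans[OF dual_basis_expansion[OF assms(1-6) ab(1)] this]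
    dual_basis_expansion[OF assms(1-6) ab(2), symmetric]]
  show ?thesis .
qed

lemma of_bit_add: "(of_bool (x + y = 1) :: int) = (of_bool (x = 1) + of_bool (y = 1)) mod 2" for x y :: bit
  by (cases x; cases y) auto

text \<open>The isomorphism lists all character values. It is injective because the characters
  separate points; a preimage of a 0-1 vector is the product of the basis elements at its
  ones.\<close>

lemma (in comm_group) dual_basis_iso:
  fixes \<chi> :: "'i \<Rightarrow> 'a \<Rightarrow> bit"
  assumes fin: "finite I" and g: "g \<in> I \<rightarrow> carrier G" and sq: "\<And>i. i \<in> I \<Longrightarrow> g i \<otimes> g i = \<one>"
    and gen: "carrier G = generate G (g ` I)"
    and char: "\<And>i a b. i \<in> I \<Longrightarrow> a \<in> carrier G \<Longrightarrow> b \<in> carrier G \<Longrightarrow> \<chi> i (a \<otimes> b) = \<chi> i a + \<chi> i b"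
    and dual: "\<And>i j. i \<in> I \<Longrightarrow> j \<in> I \<Longrightarrow> \<chi> i (g j) = of_bool (i = j)"
  shows "G \<cong> C2_pow (card I)"
proof -
  obtain e where e: "bij_betw e {..<card I} I"
    using ex_bij_betw_nat_finite[OF fin] by (auto simp: atLeast0LessThan)
  have eI: "e t \<in> I" if "t < card I" for t using e that by (auto simp: bij_betw_def)
  define h where "h a = (\<lambda>t\<in>{..<card I}. of_bool (\<chi> (e t) a = 1) :: int)" for a
  have "h \<in> iso G (C2_pow (card I))"
  proof (rule isoI)
    show "h \<in> hom G (C2_pow (card I))"
      by (rule homI)
        (auto simp: C2_pow_def h_def carrier_integer_mod_group char[OF eI] of_bit_add intro!: restrict_ext)
    show "bij_betw h (carrier G) (carrier (C2_pow (card I)))"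
      unfolding bij_betw_def
    proof
      show "inj_on h (carrier G)"
      proof (rule inj_onI)
        fix a b assume ab: "a \<in> carrier G" "b \<in> carrier G" "h a = h b"
        have "\<chi> i a = \<chi> i b" if "i \<in> I" for i
        proof -
          have "i \<in> e ` {..<card I}" using e that by (simp add: bij_betw_def)
          then obtain t where t: "t < card I" "e t = i" by auto
          have "h a t = h b t" using ab by simp
          then show ?thesis using t by (cases "\<chi> i a"; cases "\<chi> i b") (auto simp: h_def)
        qed
        then show "a = b" using dual_basis_inj[OF assms ab(1,2)] by auto
      qed
      show "h ` carrier G = carrier (C2_pow (card I))"
      proof
        show "h ` carrier G \<subseteq> carrier (C2_pow (card I))"
          by (auto simp: C2_pow_def h_def carrier_integer_mod_group split: if_splits)
        show "carrier (C2_pow (card I)) \<subseteq> h ` carrier G"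
        proof
          fix s assume "s \<in> carrier (C2_pow (card I))"
          then have s: "s \<in> (\<Pi>\<^sub>E t\<in>{..<card I}. {0..<2})"
            by (simp add: C2_pow_def carrier_integer_mod_group)
          define f where "f t = (if s t = 1 then g (e t) else \<one>)" for t
          define a where "a = (\<Otimes>t\<in>{..<card I}. f t)"
          have f: "f \<in> {..<card I} \<rightarrow> carrier G" using g eI by (auto simp: f_def)
          have a: "a \<in> carrier G" unfolding a_def using f by (rule finprod_closed)
          have "h a = s"
          proof
            fix t
            show "h a t = s t"
            proof (cases "t < card I")
              case True
              have \<chi>1: "\<chi> (e t) \<one> = 0"
                using char[OF eI[OF True], of \<one> \<one>] by (cases "\<chi> (e t) \<one>") auto
              have "\<chi> (e t) a = (\<Sum>u\<in>{..<card I}. \<chi> (e t) (f u))"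
                unfolding a_def by (rule finprod_char) (use f char[OF eI[OF True]] in auto)
              also have "\<dots> = (\<Sum>u\<in>{..<card I}. if t = u then of_bool (s u = 1) else 0)"
              proof (rule sum.cong[OF HOL.refl])
                fix u assume "u \<in> {..<card I}"
                then have "e t = e u \<longleftrightarrow> t = u" "e u \<in> I"
                  using e True eI by (auto simp: bij_betw_def dest: inj_onD)
                then show "\<chi> (e t) (f u) = (if t = u then of_bool (s u = 1) else 0)"
                  using dual[OF eI[OF True], of "e u"] \<chi>1 by (cases "t = u") (auto simp: f_def)
              qed
              also have "\<dots> = of_bool (s t = 1)"
                unfolding sum.delta'[OF finite_lessThan] using True by simp
              finally have "h a t = of_bool (s t = 1)" using True by (simp add: h_def)
              moreover have "s t \<in> {0..<2}" using s True by (auto simp: PiE_iff)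
              then have "s t = 0 \<or> s t = 1" by force
              ultimately show ?thesis by (elim disjE) simp_all
            next
              case False
              \<comment> \<open>Beyond the index range both functions take the value
                \<open>undefined\<close>.\<close>
              then show ?thesis using PiE_arb[OF s] by (simp add: h_def)
            qed
          qed
          then show "s \<in> h ` carrier G" using a by auto
        qed
      qed
    qed
  qed
  then show ?thesis by (auto simp: is_iso_def)
qed

lemma (in group) generated_comm_group:
  assumes S: "S \<subseteq> carrier G" "\<And>s t. s \<in> S \<Longrightarrow> t \<in> S \<Longrightarrow> s \<otimes> t = t \<otimes> s"
  shows "comm_group (G\<lparr>carrier := generate G S\<rparr>)"
proof -
  have "group (G\<lparr>carrier := generate G S\<rparr>)"
    by (rule subgroup_imp_group[OF generate_is_subgroup[OF S(1)]])
  then show ?thesis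
    by (rule group.group_comm_groupI) (use generate_commute2[OF S(1,1,2)] in auto)
qed

text \<open>Additivity is asked on the generated subgroup only: the coordinates
  \<open>bcoord\<close> and \<open>dcoord\<close> used below are not additive on the whole wreath
  product.\<close>

lemma (in group) generated_dual_basis:
  fixes \<chi> :: "'i \<Rightarrow> 'a \<Rightarrow> bit"
  assumes fin: "finite I" and g: "g \<in> I \<rightarrow> carrier G" "\<And>i. i \<in> I \<Longrightarrow> g i \<otimes> g i = \<one>"
    and com: "\<And>i j. i \<in> I \<Longrightarrow> j \<in> I \<Longrightarrow> g i \<otimes> g j = g j \<otimes> g i"
    and char: "\<And>i a b. i \<in> I \<Longrightarrow> a \<in> generate G (g ` I) \<Longrightarrow> b \<in> generate G (g ` I) \<Longrightarrow>
      \<chi> i (a \<otimes> b) = \<chi> i a + \<chi> i b"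
    and dual: "\<And>i j. i \<in> I \<Longrightarrow> j \<in> I \<Longrightarrow> \<chi> i (g j) = of_bool (i = j)"
  shows "G\<lparr>carrier := generate G (g ` I)\<rparr> \<cong> C2_pow (card I)"
    and "a \<in> generate G (g ` I) \<Longrightarrow> b \<in> generate G (g ` I) \<Longrightarrow> (\<And>i. i \<in> I \<Longrightarrow> \<chi> i a = \<chi> i b) \<Longrightarrow> a = b"
proof -
  let ?H = "generate G (g ` I)"
  let ?K = "G\<lparr>carrier := ?H\<rparr>"
  have S: "g ` I \<subseteq> carrier G" using g by auto
  have K: "comm_group ?K" by (rule generated_comm_group[OF S]) (use com in auto)
  have in_H: "g \<in> I \<rightarrow> carrier ?K" by (auto intro: generate.incl)
  have gen: "carrier ?K = generate ?K (g ` I)"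
    using generate_consistent[OF _ generate_is_subgroup[OF S], of "g ` I"] in_H by (auto simp: image_subset_iff Pi_iff)
  show "?K \<cong> C2_pow (card I)"
    by (rule comm_group.dual_basis_iso[OF K fin in_H _ gen, of \<chi>]) (use g char dual in auto)
  show "a = b" if "a \<in> ?H" "b \<in> ?H" "\<And>i. i \<in> I \<Longrightarrow> \<chi> i a = \<chi> i b"
    by (rule comm_group.dual_basis_inj[OF K fin in_H _ gen, of \<chi>]) (use g char dual that in auto)
qed

text \<open>Characters that vanish on \<open>N\<close> are constant on its cosets, so they descend
  to the quotient and stay dual to the images of the generators.\<close>

lemma (in group) quotient_dual_basis_iso:
  fixes \<chi> :: "'i \<Rightarrow> 'a \<Rightarrow> bit"
  assumes N: "N \<lhd> G" and com: "comm_group (G Mod N)"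
    and fin: "finite I" and g: "g \<in> I \<rightarrow> carrier G" "\<And>i. i \<in> I \<Longrightarrow> g i \<otimes> g i = \<one>"
    and gen: "carrier G = generate G (g ` I)"
    and char: "\<And>i a b. i \<in> I \<Longrightarrow> a \<in> carrier G \<Longrightarrow> b \<in> carrier G \<Longrightarrow> \<chi> i (a \<otimes> b) = \<chi> i a + \<chi> i b"
    and ker: "\<And>i a. i \<in> I \<Longrightarrow> a \<in> N \<Longrightarrow> \<chi> i a = 0"
    and dual: "\<And>i j. i \<in> I \<Longrightarrow> j \<in> I \<Longrightarrow> \<chi> i (g j) = of_bool (i = j)"
  shows "G Mod N \<cong> C2_pow (card I)"
proof -
  interpret N: normal N G by fact
  define \<psi> where "\<psi> i A = \<chi> i (SOME a. a \<in> A)" for i A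
  have \<psi>: "\<psi> i (N #> a) = \<chi> i a" if "i \<in> I" "a \<in> carrier G" for i a
  proof -
    have "a \<in> N #> a" using rcos_self[OF that(2) N.subgroup_axioms] .
    then have "(SOME b. b \<in> N #> a) \<in> N #> a" by (rule someI)
    then obtain m where m: "m \<in> N" "(SOME b. b \<in> N #> a) = m \<otimes> a" by (auto simp: r_coset_def)
    then show ?thesis using char[OF that(1) _ that(2), of m] ker[OF that(1) m(1)] by (simp add: \<psi>_def)
  qed
  have S: "g ` I \<subseteq> carrier G" using g by auto
  have q: "group_hom G (G Mod N) (\<lambda>a. N #> a)"
    by (intro group_hom.intro group_hom_axioms.intro is_group N.factorgroup_is_group N.r_coset_hom_Mod)
  have mult: "(N #> a) \<otimes>\<^bsub>G Mod N\<^esub> (N #> b) = N #> (a \<otimes> b)" if "a \<in> carrier G" "b \<in> carrier G" for a b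
    unfolding mult_FactGroup using that by (rule N.rcos_sum)
  have carr: "carrier (G Mod N) = (\<lambda>a. N #> a) ` carrier G" by (rule carrier_FactGroup)
  show ?thesis
  proof (rule comm_group.dual_basis_iso[OF com fin, where g = "\<lambda>i. N #> g i" and \<chi> = \<psi>])
    show "(\<lambda>i. N #> g i) \<in> I \<rightarrow> carrier (G Mod N)" using g by (auto simp: carr)
    show "(N #> g i) \<otimes>\<^bsub>G Mod N\<^esub> (N #> g i) = \<one>\<^bsub>G Mod N\<^esub>" if "i \<in> I" for i
      using that g mult[of "g i" "g i"] coset_mult_one[OF N.subset] by (auto simp del: mult_FactGroup)
    show "carrier (G Mod N) = generate (G Mod N) ((\<lambda>i. N #> g i) ` I)"
      using group_hom.generate_img[OF q S] gen carr by (simp add: image_image)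
    show "\<psi> i (A \<otimes>\<^bsub>G Mod N\<^esub> B) = \<psi> i A + \<psi> i B"
      if iAB: "i \<in> I" "A \<in> carrier (G Mod N)" "B \<in> carrier (G Mod N)" for i A B
    proof -
      obtain a b where ab: "a \<in> carrier G" "b \<in> carrier G" "A = N #> a" "B = N #> b"
        using iAB(2,3) unfolding carr by blast
      show ?thesis unfolding ab(3,4) mult[OF ab(1,2)] using iAB(1) ab(1,2) by (simp only: \<psi> char m_closed)
    qed
    show "\<psi> i (N #> g j) = of_bool (i = j)" if "i \<in> I" "j \<in> I" for i j
      using that g \<psi> dual by (simp add: Pi_iff)
  qed
qed

lemma (in group) finite_if_quotient_finite:
  assumes "N \<lhd> G" "finite N" "finite (carrier (G Mod N))"
  shows "finite (carrier G)"
proof -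
  have N: "subgroup N G" using assms(1) by (rule normal_imp_subgroup)
  have "card (rcosets N) > 0"
    using assms(3) rcosetsI[OF subgroup.subset[OF N] one_closed] by (auto simp: FactGroup_def card_gt_0_iff)
  moreover have "card N > 0" using assms(2) subgroup.one_closed[OF N] by (auto simp: card_gt_0_iff)
  \<comment> \<open>Lagrange's equation also holds for infinite groups, with cardinality 0 for an
    infinite set, so a positive product forces finiteness.\<close>
  ultimately have "order G > 0" using lagrange[OF N] by (metis nat_0_less_mult_iff)
  then show ?thesis by (simp add: order_def card_gt_0_iff)
qed

lemma finite_C2_pow: "finite (carrier (C2_pow m))"
  by (auto simp: C2_pow_def carrier_integer_mod_group intro: finite_PiE)

lemma iso_C2_pow_finite: "K \<cong> C2_pow m \<Longrightarrow> finite (carrier K)"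
  using finite_C2_pow by (auto simp: is_iso_def iso_def bij_betw_finite)

lemma sum_list_nth_conv: "sum_list (map f us) = (\<Sum>u<length us. f (us ! u))"
  for f :: "'a \<Rightarrow> 'b :: comm_monoid_add"
  by (simp add: sum_list_sum_nth atLeast0LessThan)

text \<open>A word in the generators is a right fold, so its character value is the sum over its
  letters. The subgroup \<open>S\<close> is a parameter because some characters are additive on the
  whole group and others only on \<open>D\<close>.\<close>

lemma (in group) foldr_char:
  fixes \<chi> :: "'a \<Rightarrow> bit"
  assumes "subgroup S G" "\<And>a b. a \<in> S \<Longrightarrow> b \<in> S \<Longrightarrow> \<chi> (a \<otimes> b) = \<chi> a + \<chi> b" "set us \<subseteq> S"
  shows "foldr (\<otimes>) us \<one> \<in> S" and "\<chi> (foldr (\<otimes>) us \<one>) = sum_list (map \<chi> us)"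
proof -
  interpret S: subgroup S G by fact
  have "\<chi> \<one> = \<chi> \<one> + \<chi> \<one>" using assms(2)[OF S.one_closed S.one_closed] by simp
  then have one: "\<chi> \<one> = 0" by (cases "\<chi> \<one>") auto
  have "foldr (\<otimes>) us \<one> \<in> S \<and> \<chi> (foldr (\<otimes>) us \<one>) = sum_list (map \<chi> us)"
    using assms(3) by (induction us) (auto simp: one assms(2))
  then show "foldr (\<otimes>) us \<one> \<in> S" "\<chi> (foldr (\<otimes>) us \<one>) = sum_list (map \<chi> us)" by auto
qed


section \<open>The wreath product of \<open>C\<^sub>2\<close> by \<open>C\<^sub>2\<^sup>2\<close>\<close>

text \<open>Multiplication in the semidirect product of \<open>F\<^sub>2[s, t]/(s\<^sup>2, t\<^sup>2)\<close> by \<open>C\<^sub>2\<^sup>2\<close>, whose two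
  generators act as multiplication by \<open>1 + s\<close> and \<open>1 + t\<close>: the tuple \<open>(p, q, a, b, c, d)\<close> stands for
  \<open>(p, q)\<close> together with the polynomial \<open>a + b s + c t + d s t\<close>. This is a wreath product because the ring is the group
  algebra of \<open>C\<^sub>2\<^sup>2\<close>.\<close>

definition wreath :: "(bit \<times> bit \<times> bit \<times> bit \<times> bit \<times> bit) monoid" where
  "wreath = \<lparr>carrier = UNIV,
     monoid.mult = (\<lambda>(p, q, a, b, c, d) (p', q', a', b', c', d').
       (p + p', q + q', a + a', b + p' * a + b', c + q' * a + c',
        d + p' * c + q' * b + p' * q' * a + d')),
     one = (0, 0, 0, 0, 0, 0)\<rparr>"

lemma bit_add_self [simp]: "a + a = 0" for a :: bit
  by (cases a) auto

lemma bit_add_self_left [simp]: "a + (a + b) = b" for a b :: bit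
  by (cases a; cases b) auto

lemma wreath_simps [simp]:
  "carrier wreath = UNIV"
  "\<one>\<^bsub>wreath\<^esub> = (0, 0, 0, 0, 0, 0)"
  "(p, q, a, b, c, d) \<otimes>\<^bsub>wreath\<^esub> (p', q', a', b', c', d') =
     (p + p', q + q', a + a', b + p' * a + b', c + q' * a + c', d + p' * c + q' * b + p' * q' * a + d')"
  by (simp_all add: wreath_def)

lemma group_wreath: "group wreath"
proof (rule groupI)
  fix x y z :: "bit \<times> bit \<times> bit \<times> bit \<times> bit \<times> bit"
  show "x \<otimes>\<^bsub>wreath\<^esub> y \<otimes>\<^bsub>wreath\<^esub> z = x \<otimes>\<^bsub>wreath\<^esub> (y \<otimes>\<^bsub>wreath\<^esub> z)"
    by (cases x; cases y; cases z) (simp add: algebra_simps)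
  obtain p q a b c d where x: "x = (p, q, a, b, c, d)" by (cases x)
  \<comment> \<open>As \<open>s\<close> and \<open>t\<close> square to zero in characteristic 2,
    \<open>1 + p s\<close> and \<open>1 + q t\<close> are their own inverses. The entries after
    \<open>p\<close> and \<open>q\<close> are the coefficients of the polynomial multiplied by
    both.\<close>
  have "(p, q, a, b + p * a, c + q * a, d + p * c + q * b + p * q * a) \<otimes>\<^bsub>wreath\<^esub> x = \<one>\<^bsub>wreath\<^esub>"
    unfolding x by (simp add: algebra_simps)
  then show "\<exists>y\<in>carrier wreath. y \<otimes>\<^bsub>wreath\<^esub> x = \<one>\<^bsub>wreath\<^esub>"
    by (intro bexI) (assumption, simp)
next
  show "\<one>\<^bsub>wreath\<^esub> \<otimes>\<^bsub>wreath\<^esub> x = x" for x by (cases x) simp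
qed auto

interpretation wreath: group wreath by (rule group_wreath)

text \<open>The coefficient of \<open>st\<close> may stay unspecified: when such a commutator is
  bracketed again, \<open>wreath_commutator_left\<close> gives a value that does not involve
  it.\<close>

lemma wreath_commutator:
  obtains d'' where
  "commutator wreath (p, q, a, b, c, d) (p', q', a', b', c', d') =
     (0, 0, 0, p * a' + p' * a, q * a' + q' * a, d'')"
proof -
  define k where "k = commutator wreath (p, q, a, b, c, d) (p', q', a', b', c', d')"
  obtain k1 k2 k3 k4 k5 k6 where k: "k = (k1, k2, k3, k4, k5, k6)" by (cases k)
  have "(p, q, a, b, c, d) \<otimes>\<^bsub>wreath\<^esub> (p', q', a', b', c', d') =
      (p', q', a', b', c', d') \<otimes>\<^bsub>wreath\<^esub> (p, q, a, b, c, d) \<otimes>\<^bsub>wreath\<^esub> k"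
    unfolding k_def by (rule wreath.commutator_swap) auto
  then have 1: "p + p' = p' + p + k1" "q + q' = q' + q + k2" "a + a' = a' + a + k3"
    "b + p' * a + b' = b' + p * a' + b + k1 * (a' + a) + k4"
    "c + q' * a + c' = c' + q * a' + c + k2 * (a' + a) + k5"
    by (simp_all add: k)
  then have k0: "k1 = 0" "k2 = 0" "k3 = 0" by (simp_all add: add.commute)
  then have "k4 = p * a' + p' * a" "k5 = q * a' + q' * a"
    using 1(4,5) by (cases b; cases b'; cases c; cases c'; auto simp: algebra_simps; fail)+
  then show thesis using that k k_def k0 by auto
qed

text \<open>The bracket of the action \<open>(p, q)\<close> with the constant \<open>r\<close> is
  \<open>r\<close> times \<open>(1 + p s)(1 + q t) - 1\<close>.\<close>

lemma wreath_commutator_XY: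
  "commutator wreath (p, q, 0, 0, 0, 0) (0, 0, r, 0, 0, 0) = (0, 0, 0, p * r, q * r, p * q * r)"
  by (rule wreath.commutator_eqI) (simp_all add: algebra_simps)

text \<open>Again multiplication by \<open>(1 + p s)(1 + q t) - 1\<close>, now of a polynomial
  without constant term, so that only the mixed products survive.\<close>

lemma wreath_commutator_left:
  "commutator wreath (0, 0, 0, b, c, d) (p, q, a, b', c', d') = (0, 0, 0, 0, 0, p * c + q * b)"
  by (rule wreath.commutator_eqI) (simp_all add: algebra_simps)

lemma wreath_commutator_XX: "commutator wreath (p, q, 0, 0, 0, 0) (p', q', 0, 0, 0, 0) = (0, 0, 0, 0, 0, 0)"
  and wreath_commutator_YY: "commutator wreath (0, 0, r, 0, 0, 0) (0, 0, r', 0, 0, 0) = (0, 0, 0, 0, 0, 0)"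
  by (rule wreath.commutator_eqI; simp add: algebra_simps)+

text \<open>Each commutator lies in the ideal \<open>(s, t)\<close>, and each further bracket
  multiplies by an element of this ideal, whose cube is zero; so the test group has class at most
  three. Brackets of commutators with images of the \<open>y_i\<close> die because the base group is
  abelian. As \<open>p\<close>, \<open>q\<close> and \<open>r\<close> are arbitrary, every choice of
  them yields a test homomorphism.\<close>

lemma H_relations_wreath:
  "H_relations wreath ((\<lambda>i. (p i, q i, 0, 0, 0, 0)) ` A) ((\<lambda>i. (0, 0, r i, 0, 0, 0)) ` B)"
proof
  fix z z' z'' z''' :: "bit \<times> bit \<times> bit \<times> bit \<times> bit \<times> bit"
  obtain z1 z2 z3 z4 z5 z6 where z: "z = (z1, z2, z3, z4, z5, z6)" by (cases z)
  obtain w1 w2 w3 w4 w5 w6 where w: "z' = (w1, w2, w3, w4, w5, w6)" by (cases z')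
  obtain u1 u2 u3 u4 u5 u6 where u: "z'' = (u1, u2, u3, u4, u5, u6)" by (cases z'')
  obtain v1 v2 v3 v4 v5 v6 where v: "z''' = (v1, v2, v3, v4, v5, v6)" by (cases z''')
  obtain d where d: "commutator wreath z z' = (0, 0, 0, z1 * w3 + w1 * z3, z2 * w3 + w2 * z3, d)"
    unfolding z w by (rule wreath_commutator)
  show "commutator wreath (commutator wreath (commutator wreath z z') z'') z''' = \<one>\<^bsub>wreath\<^esub>"
    unfolding d u v wreath_commutator_left by simp
next
  fix x y y' :: "bit \<times> bit \<times> bit \<times> bit \<times> bit \<times> bit"
  assume "x \<in> (\<lambda>i. (p i, q i, 0, 0, 0, 0)) ` A"
    "y \<in> (\<lambda>i. (0, 0, r i, 0, 0, 0)) ` B" "y' \<in> (\<lambda>i. (0, 0, r i, 0, 0, 0)) ` B"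
  then obtain i j k where "x = (p i, q i, 0, 0, 0, 0)" "y = (0, 0, r j, 0, 0, 0)" "y' = (0, 0, r k, 0, 0, 0)" by auto
  moreover obtain d where "commutator wreath (0, 0, r j, 0, 0, 0) (p i, q i, 0, 0, 0, 0) =
    (0, 0, 0, 0 * 0 + p i * r j, 0 * 0 + q i * r j, d)" by (rule wreath_commutator)
  ultimately show "commutator wreath (commutator wreath y x) y' = \<one>\<^bsub>wreath\<^esub>"
    by (simp add: wreath_commutator_left)
next
  let ?X = "(\<lambda>i. (p i, q i, 0, 0, 0, 0)) ` A" and ?Y = "(\<lambda>i. (0, 0, r i, 0, 0, 0)) ` B"
  show "?X \<subseteq> carrier wreath" "?Y \<subseteq> carrier wreath" by simp_all
  show "z \<otimes>\<^bsub>wreath\<^esub> z = \<one>\<^bsub>wreath\<^esub>" if "z \<in> ?X \<union> ?Y" for z using that by auto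
  show "commutator wreath x x' = \<one>\<^bsub>wreath\<^esub>" if "x \<in> ?X" "x' \<in> ?X" for x x'
    using that by (auto simp: wreath_commutator_XX)
  show "commutator wreath x x' = \<one>\<^bsub>wreath\<^esub>" if "x \<in> ?Y" "x' \<in> ?Y" for x x'
    using that by (auto simp: wreath_commutator_YY)
  show "commutator wreath x y \<otimes>\<^bsub>wreath\<^esub> commutator wreath x y = \<one>\<^bsub>wreath\<^esub>" if "x \<in> ?X" "y \<in> ?Y" for x y
    using that by (auto simp: wreath_commutator_XY)
  show "commutator wreath (commutator wreath x y) z \<otimes>\<^bsub>wreath\<^esub> commutator wreath (commutator wreath x y) z = \<one>\<^bsub>wreath\<^esub>"
    if "x \<in> ?X" "y \<in> ?Y" for x y z
    using that by (cases z) (auto simp: wreath_commutator_XY wreath_commutator_left)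
qed

section \<open>Characters of \<open>\<H>(n)\<close>\<close>

text \<open>Here \<open>x_i\<close> goes to the action by \<open>(1 + s)^(p i) (1 + t)^(q i)\<close>
  and \<open>y_i\<close> to the constant \<open>r i\<close>. With indicator functions for
  \<open>p\<close>, \<open>q\<close>, \<open>r\<close> all but a few generators become
  trivial.\<close>

definition test_hom :: "nat \<Rightarrow> (nat \<Rightarrow> bit) \<Rightarrow> (nat \<Rightarrow> bit) \<Rightarrow> (nat \<Rightarrow> bit) \<Rightarrow>
    gen word set \<Rightarrow> bit \<times> bit \<times> bit \<times> bit \<times> bit \<times> bit" where
  "test_hom n p q r = (SOME h. h \<in> hom (HH n) wreath \<and>
     (\<forall>i\<in>{1..n}. h (gx n i) = (p i, q i, 0, 0, 0, 0) \<and> h (gy n i) = (0, 0, r i, 0, 0, 0)))"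

lemma test_hom:
  shows test_hom_hom: "test_hom n p q r \<in> hom (HH n) wreath"
    and test_hom_gx: "i \<in> {1..n} \<Longrightarrow> test_hom n p q r (gx n i) = (p i, q i, 0, 0, 0, 0)"
    and test_hom_gy: "i \<in> {1..n} \<Longrightarrow> test_hom n p q r (gy n i) = (0, 0, r i, 0, 0, 0)"
proof -
  obtain h where "h \<in> hom (HH n) wreath"
    "\<And>i. i \<in> {1..n} \<Longrightarrow> h (gx n i) = (p i, q i, 0, 0, 0, 0)"
    "\<And>i. i \<in> {1..n} \<Longrightarrow> h (gy n i) = (0, 0, r i, 0, 0, 0)"
    by (rule HH_universal[OF group_wreath _ _ H_relations_wreath[of p q "{1..n}" r "{1..n}"]]) auto
  then have "\<exists>h. h \<in> hom (HH n) wreath \<and>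
     (\<forall>i\<in>{1..n}. h (gx n i) = (p i, q i, 0, 0, 0, 0) \<and> h (gy n i) = (0, 0, r i, 0, 0, 0))"
    by blast
  from someI_ex[OF this, folded test_hom_def]
  show "test_hom n p q r \<in> hom (HH n) wreath"
    "i \<in> {1..n} \<Longrightarrow> test_hom n p q r (gx n i) = (p i, q i, 0, 0, 0, 0)"
    "i \<in> {1..n} \<Longrightarrow> test_hom n p q r (gy n i) = (0, 0, r i, 0, 0, 0)" by auto
qed

definition pcoord :: "bit \<times> bit \<times> bit \<times> bit \<times> bit \<times> bit \<Rightarrow> bit" where
  "pcoord = (\<lambda>(p, q, a, b, c, d). p)"
definition acoord :: "bit \<times> bit \<times> bit \<times> bit \<times> bit \<times> bit \<Rightarrow> bit" where
  "acoord = (\<lambda>(p, q, a, b, c, d). a)"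
definition bcoord :: "bit \<times> bit \<times> bit \<times> bit \<times> bit \<times> bit \<Rightarrow> bit" where
  "bcoord = (\<lambda>(p, q, a, b, c, d). b)"
definition dcoord :: "bit \<times> bit \<times> bit \<times> bit \<times> bit \<times> bit \<Rightarrow> bit" where
  "dcoord = (\<lambda>(p, q, a, b, c, d). d)"

lemma coord_simps [simp]:
  "pcoord (p, q, a, b, c, d) = p" "acoord (p, q, a, b, c, d) = a"
  "bcoord (p, q, a, b, c, d) = b" "dcoord (p, q, a, b, c, d) = d"
  by (simp_all add: pcoord_def acoord_def bcoord_def dcoord_def)

lemma coord_mult:
  "pcoord (s \<otimes>\<^bsub>wreath\<^esub> t) = pcoord s + pcoord t" "acoord (s \<otimes>\<^bsub>wreath\<^esub> t) = acoord s + acoord t"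
  by (cases s; cases t; simp)+

text \<open>An alternating bilinear form in the coordinates \<open>p\<close> and \<open>a\<close>,
  both of which are characters. It is the source of the double product in (6).\<close>

lemma bcoord_commutator:
  "bcoord (commutator wreath s t) = pcoord s * acoord t + pcoord t * acoord s"
proof -
  obtain p q a b c d p' q' a' b' c' d' where "s = (p, q, a, b, c, d)" "t = (p', q', a', b', c', d')"
    by (cases s; cases t)
  then show ?thesis using wreath_commutator[of p q a b c d p' q' a' b' c' d'] by (metis coord_simps)
qed

definition \<delta> :: "nat \<Rightarrow> nat \<Rightarrow> bit" where "\<delta> i j = of_bool (i = j)"

fun derived_basis :: "nat \<Rightarrow> (nat \<times> nat) + (nat \<times> nat \<times> nat) \<Rightarrow> gen word set" where
  "derived_basis n (Inl (i, j)) = commutator (HH n) (gx n i) (gy n j)"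
| "derived_basis n (Inr (i, j, k)) =
     commutator (HH n) (commutator (HH n) (gx n i) (gy n j)) (gx n k)"

text \<open>The coefficient \<open>b\<close> of \<open>c_uv\<close> is \<open>p_u r_v\<close>. The
  coefficient \<open>d\<close> of \<open>e_uvw\<close> is \<open>(p_w q_u + q_w p_u) r_v\<close>,
  symmetric in \<open>u\<close> and \<open>w\<close> just as \<open>e_uvw\<close> is; on
  \<open>c_uv\<close> it equals \<open>p_u q_u r_v\<close>, which vanishes when \<open>p\<close> and
  \<open>q\<close> mark different indices.\<close>

fun derived_char :: "nat \<Rightarrow> (nat \<times> nat) + (nat \<times> nat \<times> nat) \<Rightarrow> gen word set \<Rightarrow> bit" where
  "derived_char n (Inl (i, j)) g = bcoord (test_hom n (\<delta> i) (\<lambda>_. 0) (\<delta> j) g)"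
| "derived_char n (Inr (i, j, k)) g = dcoord (test_hom n (\<delta> i) (\<delta> k) (\<delta> j) g)"

section \<open>Index sets and their sizes\<close>

definition index2 :: "nat \<Rightarrow> (nat \<times> nat) set" where
  "index2 n = {1..n} \<times> {1..n}"
definition index3 :: "nat \<Rightarrow> (nat \<times> nat \<times> nat) set" where
  "index3 n = {(i, j, k). i \<in> {1..n} \<and> j \<in> {1..n} \<and> i < k \<and> k \<le> n}"

lemma finite_index: "finite (index2 n)" "finite (index3 n)"
proof -
  have "index3 n \<subseteq> {1..n} \<times> {1..n} \<times> {1..n}" by (auto simp: index3_def)
  then show "finite (index3 n)" by (rule finite_subset) auto
qed (simp add: index2_def)

lemma card_index2: "card (index2 n) = n\<^sup>2"
  by (simp add: index2_def power2_eq_square)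

lemma card_index3: "card (index3 n) = n\<^sup>2 * (n - 1) div 2"
proof -
  \<comment> \<open>Sorted by the last index \<open>k\<close>, each fibre has
    \<open>(k - 1) n\<close> elements.\<close>
  have "bij_betw (\<lambda>(k, i, j). (i, j, k)) (SIGMA k:{1..n}. {1..<k} \<times> {1..n}) (index3 n)"
    by (rule bij_betwI[where g = "\<lambda>(i, j, k). (k, i, j)"]) (auto simp: index3_def)
  then have "card (index3 n) = card (SIGMA k:{1..n}. {1..<k} \<times> {1..n})"
    by (metis bij_betw_same_card)
  also have "\<dots> = (\<Sum>k=1..n. (k - 1) * n)" by simp
  also have "\<dots> = (\<Sum>k=1..n. k - 1) * n" by (simp add: sum_distrib_right)
  also have "(\<Sum>k=1..n. k - 1) = n * (n - 1) div 2"
  proof (induction n)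
    case (Suc m)
    then show ?case by (cases m) (auto simp: algebra_simps)
  qed simp
  also have "n * (n - 1) div 2 * n = n\<^sup>2 * (n - 1) div 2"
  proof -
    \<comment> \<open>Parity is what lets the division by 2 pass the factor
      \<open>n\<close>.\<close>
    have "even (n * (n - 1))" by (cases n) auto
    then show ?thesis by (simp add: power2_eq_square div_mult_swap mult.assoc mult.commute mult.left_commute)
  qed
  finally show ?thesis .
qed

lemma card_index: "card (index2 n <+> index3 n) = n\<^sup>2 * (n + 1) div 2"
proof -
  have "even (n\<^sup>2 * (n - 1))" by (cases n) (auto simp: power2_eq_square)
  moreover have "n\<^sup>2 * (n + 1) = n\<^sup>2 * (n - 1) + 2 * n\<^sup>2" by (cases n) (auto simp: algebra_simps)
  ultimately have "n\<^sup>2 * (n + 1) div 2 = n\<^sup>2 + n\<^sup>2 * (n - 1) div 2" by simp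
  then show ?thesis by (simp add: card_Plus finite_index card_index2 card_index3)
qed

declare One_nat_def [simp del]

context
  fixes n :: nat
begin

interpretation H: H_group "HH n" "gx n ` {1..n}" "gy n ` {1..n}"
  by (rule H_group_HH)

lemma test_hom_basis2:
  assumes "i \<in> {1..n}" "j \<in> {1..n}"
  shows "test_hom n p q r (commutator (HH n) (gx n i) (gy n j)) =
    (0, 0, 0, p i * r j, q i * r j, p i * q i * r j)"
  using assms hom_commutator[OF group_HH group_wreath test_hom_hom, of "gx n i" n "gy n j"]
  by (simp only: gx_closed gy_closed test_hom_gx test_hom_gy wreath_commutator_XY)

lemma test_hom_basis3:
  assumes "i \<in> {1..n}" "j \<in> {1..n}" "k \<in> {1..n}"
  shows "test_hom n p q r (commutator (HH n) (commutator (HH n) (gx n i) (gy n j)) (gx n k)) =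
    (0, 0, 0, 0, 0, p k * (q i * r j) + q k * (p i * r j))"
  using assms hom_commutator[OF group_HH group_wreath test_hom_hom,
      of "commutator (HH n) (gx n i) (gy n j)" n "gx n k"]
  by (simp only: gx_closed gy_closed test_hom_gx test_hom_basis2 wreath_commutator_left H.commutator_closed)

section \<open>Spanning sets of \<open>F\<close> and \<open>D\<close>\<close>

lemma Eset_subset: "H.Eset \<subseteq> derived_basis n ` Inr ` index3 n \<union> {\<one>\<^bsub>HH n\<^esub>}"
proof
  fix e assume "e \<in> H.Eset"
  then obtain i j k where ijk: "i \<in> {1..n}" "j \<in> {1..n}" "k \<in> {1..n}"
    and e: "e = commutator (HH n) (commutator (HH n) (gx n i) (gy n j)) (gx n k)"
    unfolding H.Eset_def by auto
  consider "i = k" | "i < k" | "k < i" by linarith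
  then show "e \<in> derived_basis n ` Inr ` index3 n \<union> {\<one>\<^bsub>HH n\<^esub>}"
  proof cases
    case 1
    then show ?thesis using e ijk H.comm_comm_self by simp
  next
    case 2
    then have "(i, j, k) \<in> index3 n" using ijk by (auto simp: index3_def)
    then show ?thesis using e by (force simp: image_image)
  next
    case 3
    then have "(k, j, i) \<in> index3 n" using ijk by (auto simp: index3_def)
    moreover have "e = derived_basis n (Inr (k, j, i))"
      using e H.comm_comm_swap[of "gx n i" "gx n k" "gy n j"] ijk by simp
    ultimately show ?thesis by (force simp: image_image)
  qed
qed

lemma basis3_Eset: "derived_basis n ` Inr ` index3 n \<subseteq> H.Eset"
proof -
  have "derived_basis n (Inr (i, j, k)) \<in> H.Eset" if "i \<in> {1..n}" "j \<in> {1..n}" "k \<in> {1..n}" for i j k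
    unfolding H.Eset_def derived_basis.simps using that by blast
  then show ?thesis by (auto simp: index3_def)
qed

lemma F_eq: "H.F = generate (HH n) (derived_basis n ` Inr ` index3 n)"
proof
  note sub = basis3_Eset
  then have c: "derived_basis n ` Inr ` index3 n \<subseteq> carrier (HH n)" using H.Eset_carrier by blast
  show "H.F \<subseteq> generate (HH n) (derived_basis n ` Inr ` index3 n)"
    by (rule H.generate_subgroup_incl[OF _ H.generate_is_subgroup[OF c]])
      (use Eset_subset in \<open>auto intro: generate.one generate.incl\<close>)
  show "generate (HH n) (derived_basis n ` Inr ` index3 n) \<subseteq> H.F"
    by (rule H.mono_generate[OF sub])
qed

lemma Cset_eq: "H.Cset = derived_basis n ` Inl ` index2 n"
  unfolding H.Cset_def by (force simp: index2_def image_image)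

lemma D_eq: "H.D = generate (HH n) (derived_basis n ` (index2 n <+> index3 n))"
proof -
  have e: "derived_basis n ` (index2 n <+> index3 n) = H.Cset \<union> derived_basis n ` Inr ` index3 n"
    unfolding Cset_eq Plus_def image_Un by (rule HOL.refl)
  note sub = basis3_Eset
  have c: "derived_basis n ` (index2 n <+> index3 n) \<subseteq> carrier (HH n)"
    unfolding e by (intro Un_least order.trans[OF sub H.Eset_carrier] H.Cset_carrier)
  show ?thesis
  proof
    show "H.D \<subseteq> generate (HH n) (derived_basis n ` (index2 n <+> index3 n))"
    proof (rule H.generate_subgroup_incl[OF _ H.generate_is_subgroup[OF c]])
      have "H.Cset \<union> H.Eset \<subseteq> derived_basis n ` (index2 n <+> index3 n) \<union> {\<one>\<^bsub>HH n\<^esub>}"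
        unfolding e using Eset_subset by auto
      also have "\<dots> \<subseteq> generate (HH n) (derived_basis n ` (index2 n <+> index3 n))"
        by (auto intro: generate.one generate.incl)
      finally show "H.Cset \<union> H.Eset \<subseteq> generate (HH n) (derived_basis n ` (index2 n <+> index3 n))" .
    qed
    show "generate (HH n) (derived_basis n ` (index2 n <+> index3 n)) \<subseteq> H.D"
      unfolding e by (intro H.mono_generate Un_mono sub order.refl)
  qed
qed

section \<open>Additivity and duality of the characters on \<open>D\<close>\<close>

lemma derived_basis_D: "s \<in> index2 n <+> index3 n \<Longrightarrow> derived_basis n s \<in> H.D"
  unfolding D_eq by (auto intro: generate.incl)

text \<open>The generators of \<open>D\<close> have vanishing coordinates \<open>p\<close>,
  \<open>q\<close> and \<open>a\<close>, and products preserve this. The correction terms of the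
  multiplication thus disappear on \<open>D\<close>, which makes \<open>b\<close> and
  \<open>d\<close> additive there.\<close>

lemma test_hom_D:
  assumes "d \<in> H.D"
  obtains b c e where "test_hom n p q r d = (0, 0, 0, b, c, e)"
proof -
  let ?t = "test_hom n p q r"
  interpret t: group_hom "HH n" wreath ?t
    by (simp add: group_hom_def group_hom_axioms_def test_hom_hom group_HH group_wreath)
  have S: "H.Cset \<union> H.Eset \<subseteq> carrier (HH n)" using H.Cset_carrier H.Eset_carrier by auto
  have sq: "\<forall>s\<in>H.Cset \<union> H.Eset. s \<otimes>\<^bsub>HH n\<^esub> s = \<one>\<^bsub>HH n\<^esub>" using H.Cset_square H.Eset_square by auto
  have "\<exists>b c e. ?t d = (0, 0, 0, b, c, e)"
    using assms S sq
  proof (induction rule: H.generate_involution_induct)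
    case one
    then show ?case using t.hom_one by simp
  next
    case (gen s)
    then show ?case
      by (auto simp: H.Cset_def H.Eset_def test_hom_basis2 test_hom_basis3)
  next
    case (mult a b)
    then show ?case using t.hom_mult[of a b] by auto
  qed
  then show thesis using that by blast
qed

lemma derived_char_mult:
  assumes "a \<in> H.D" "b \<in> H.D"
  shows "derived_char n s (a \<otimes>\<^bsub>HH n\<^esub> b) = derived_char n s a + derived_char n s b"
proof -
  have c: "a \<in> carrier (HH n)" "b \<in> carrier (HH n)" using assms H.D_carrier by auto
  have m: "test_hom n p q r (a \<otimes>\<^bsub>HH n\<^esub> b) = test_hom n p q r a \<otimes>\<^bsub>wreath\<^esub> test_hom n p q r b" for p q r
    using hom_mult[OF test_hom_hom c] .
  show ?thesis
  proof (cases s)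
    case (Inl ij)
    obtain i j where ij: "ij = (i, j)" by force
    let ?t = "test_hom n (\<delta> i) (\<lambda>_. 0) (\<delta> j)"
    obtain b1 c1 e1 where 1: "?t a = (0, 0, 0, b1, c1, e1)" by (rule test_hom_D[OF assms(1)])
    obtain b2 c2 e2 where 2: "?t b = (0, 0, 0, b2, c2, e2)" by (rule test_hom_D[OF assms(2)])
    show ?thesis by (simp add: Inl ij m 1 2)
  next
    case (Inr ijk)
    obtain i j k where ij: "ijk = (i, j, k)" by (cases ijk)
    let ?t = "test_hom n (\<delta> i) (\<delta> k) (\<delta> j)"
    obtain b1 c1 e1 where 1: "?t a = (0, 0, 0, b1, c1, e1)" by (rule test_hom_D[OF assms(1)])
    obtain b2 c2 e2 where 2: "?t b = (0, 0, 0, b2, c2, e2)" by (rule test_hom_D[OF assms(2)])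
    show ?thesis by (simp add: Inr ij m 1 2)
  qed
qed

text \<open>For triples \<open>(i, j, k)\<close> and \<open>(u, v, w)\<close> the competing term
  would need \<open>i = w\<close> and \<open>k = u\<close>, against \<open>i < k\<close> and
  \<open>u < w\<close>.\<close>

lemma derived_char_basis:
  assumes "s \<in> index2 n <+> index3 n" "t \<in> index2 n <+> index3 n"
  shows "derived_char n s (derived_basis n t) = of_bool (s = t)"
  using assms
  by (auto simp: index2_def index3_def test_hom_basis2 test_hom_basis3 \<delta>_def add_bit_eq_xor mult_bit_eq_and)

text \<open>Stated for any part of the basis, so that the derived subgroup, \<open>W\<close> and the
  third term of the lower central series are all instances. Additivity is inherited from
  \<open>D\<close>, which contains every such span.\<close>

lemma derived_sub_basis:
  assumes "I \<subseteq> index2 n <+> index3 n"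
  shows "HH n\<lparr>carrier := generate (HH n) (derived_basis n ` I)\<rparr> \<cong> C2_pow (card I)"
    and "a \<in> generate (HH n) (derived_basis n ` I) \<Longrightarrow> b \<in> generate (HH n) (derived_basis n ` I) \<Longrightarrow>
      (\<And>i. i \<in> I \<Longrightarrow> derived_char n i a = derived_char n i b) \<Longrightarrow> a = b"
proof -
  have fin: "finite I" using assms finite_subset finite_index by (metis finite_Plus)
  have D: "derived_basis n i \<in> H.D" if "i \<in> I" for i using that assms derived_basis_D by blast
  have sub: "generate (HH n) (derived_basis n ` I) \<subseteq> H.D"
    unfolding D_eq by (rule H.mono_generate) (use assms in blast)
  have 1: "derived_basis n \<in> I \<rightarrow> carrier (HH n)" using D H.D_carrier by auto
  have 2: "derived_basis n i \<otimes>\<^bsub>HH n\<^esub> derived_basis n i = \<one>\<^bsub>HH n\<^esub>" if "i \<in> I" for i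
    using H.D_square[OF D[OF that]] .
  have 3: "derived_basis n i \<otimes>\<^bsub>HH n\<^esub> derived_basis n j = derived_basis n j \<otimes>\<^bsub>HH n\<^esub> derived_basis n i"
    if "i \<in> I" "j \<in> I" for i j
    using H.D_commute[OF D[OF that(1)] D[OF that(2)]] .
  have 4: "derived_char n i (a \<otimes>\<^bsub>HH n\<^esub> b) = derived_char n i a + derived_char n i b"
    if "i \<in> I" "a \<in> generate (HH n) (derived_basis n ` I)" "b \<in> generate (HH n) (derived_basis n ` I)" for i a b
    using that sub derived_char_mult by blast
  have 5: "derived_char n i (derived_basis n j) = of_bool (i = j)" if "i \<in> I" "j \<in> I" for i j
    using that assms derived_char_basis by blast
  note r = H.generated_dual_basis[where g = "derived_basis n" and \<chi> = "derived_char n" and I = I, OF fin 1 2 3 4 5]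
  show "HH n\<lparr>carrier := generate (HH n) (derived_basis n ` I)\<rparr> \<cong> C2_pow (card I)"
    by (rule r(1))
  show "a \<in> generate (HH n) (derived_basis n ` I) \<Longrightarrow> b \<in> generate (HH n) (derived_basis n ` I) \<Longrightarrow>
      (\<And>i. i \<in> I \<Longrightarrow> derived_char n i a = derived_char n i b) \<Longrightarrow> a = b"
    by (rule r(2))
qed

section \<open>The structure of \<open>\<H>(n)\<close>\<close>

text \<open>The coordinates \<open>p\<close> and \<open>a\<close> receive no correction term in a
  product, so they give characters of all of \<open>HH n\<close>. They detect the generators
  themselves.\<close>

lemma pcoord_hom:
  "a \<in> carrier (HH n) \<Longrightarrow> b \<in> carrier (HH n) \<Longrightarrow>
    pcoord (test_hom n p q r (a \<otimes>\<^bsub>HH n\<^esub> b)) = pcoord (test_hom n p q r a) + pcoord (test_hom n p q r b)"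
  and acoord_hom:
  "a \<in> carrier (HH n) \<Longrightarrow> b \<in> carrier (HH n) \<Longrightarrow>
    acoord (test_hom n p q r (a \<otimes>\<^bsub>HH n\<^esub> b)) = acoord (test_hom n p q r a) + acoord (test_hom n p q r b)"
  by (simp_all add: hom_mult[OF test_hom_hom] coord_mult)

lemma X_iso: "HH n\<lparr>carrier := generate (HH n) (gx n ` {1..n})\<rparr> \<cong> C2_pow n"
proof -
  let ?\<chi> = "\<lambda>i g. pcoord (test_hom n (\<delta> i) (\<lambda>_. 0) (\<lambda>_. 0) g)"
  have sub: "generate (HH n) (gx n ` {1..n}) \<subseteq> carrier (HH n)"
    by (rule H.generate_incl[OF H.X0_carrier])
  have "HH n\<lparr>carrier := generate (HH n) (gx n ` {1..n})\<rparr> \<cong> C2_pow (card {1..n})"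
  proof (rule H.generated_dual_basis(1)[where \<chi> = ?\<chi>])
    show "?\<chi> i (a \<otimes>\<^bsub>HH n\<^esub> b) = ?\<chi> i a + ?\<chi> i b"
      if "a \<in> generate (HH n) (gx n ` {1..n})" "b \<in> generate (HH n) (gx n ` {1..n})" for i a b
      using that sub pcoord_hom by blast
  qed (auto simp: H.square H.X_commute test_hom_gx \<delta>_def)
  then show ?thesis by simp
qed

lemma Y_iso: "HH n\<lparr>carrier := generate (HH n) (gy n ` {1..n})\<rparr> \<cong> C2_pow n"
proof -
  let ?\<chi> = "\<lambda>i g. acoord (test_hom n (\<lambda>_. 0) (\<lambda>_. 0) (\<delta> i) g)"
  have sub: "generate (HH n) (gy n ` {1..n}) \<subseteq> carrier (HH n)"
    by (rule H.generate_incl[OF H.Y0_carrier])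
  have "HH n\<lparr>carrier := generate (HH n) (gy n ` {1..n})\<rparr> \<cong> C2_pow (card {1..n})"
  proof (rule H.generated_dual_basis(1)[where \<chi> = ?\<chi>])
    show "?\<chi> i (a \<otimes>\<^bsub>HH n\<^esub> b) = ?\<chi> i a + ?\<chi> i b"
      if "a \<in> generate (HH n) (gy n ` {1..n})" "b \<in> generate (HH n) (gy n ` {1..n})" for i a b
      using that sub acoord_hom by blast
  qed (auto simp: H.square H.Y_commute test_hom_gy \<delta>_def)
  then show ?thesis by simp
qed

text \<open>The characters dual to the \<open>x_i\<close> and the \<open>y_i\<close> all kill
  \<open>D\<close> by \<open>test_hom_D\<close>, so together they form a dual basis on the
  quotient.\<close>

lemma abelianization_iso: "HH n Mod derived (HH n) (carrier (HH n)) \<cong> C2_pow (2 * n)"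
proof -
  let ?I = "{1..n} <+> {1..n}"
  let ?g = "case_sum (gx n) (gy n)"
  let ?\<chi> = "case_sum (\<lambda>i g. pcoord (test_hom n (\<delta> i) (\<lambda>_. 0) (\<lambda>_. 0) g))
    (\<lambda>i g. acoord (test_hom n (\<lambda>_. 0) (\<lambda>_. 0) (\<delta> i) g))"
  have im: "?g ` ?I = gx n ` {1..n} \<union> gy n ` {1..n}"
    by (auto simp: Plus_def image_Un image_image)
  have ker: "?\<chi> s a = 0" if a: "a \<in> H.D" for s a
  proof (cases s)
    case (Inl i)
    obtain b c e where "test_hom n (\<delta> i) (\<lambda>_. 0) (\<lambda>_. 0) a = (0, 0, 0, b, c, e)"
      by (rule test_hom_D[OF a])
    then show ?thesis using Inl by simp
  next
    case (Inr i)
    obtain b c e where "test_hom n (\<lambda>_. 0) (\<lambda>_. 0) (\<delta> i) a = (0, 0, 0, b, c, e)"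
      by (rule test_hom_D[OF a])
    then show ?thesis using Inr by simp
  qed
  have "HH n Mod derived (HH n) (carrier (HH n)) \<cong> C2_pow (card ?I)"
  proof (rule H.quotient_dual_basis_iso[where g = ?g and \<chi> = ?\<chi>])
    show "derived (HH n) (carrier (HH n)) \<lhd> HH n" by (rule H.derived_self_is_normal)
    show "comm_group (HH n Mod derived (HH n) (carrier (HH n)))" by (rule H.derived_quot_is_comm_group)
    show "carrier (HH n) = generate (HH n) (?g ` ?I)" unfolding im by (rule HH_generated)
    show "?\<chi> i a = 0" if "a \<in> derived (HH n) (carrier (HH n))" for i a
      using that ker unfolding H.derived_eq by blast
    show "?\<chi> i (a \<otimes>\<^bsub>HH n\<^esub> b) = ?\<chi> i a + ?\<chi> i b" if "a \<in> carrier (HH n)" "b \<in> carrier (HH n)" for i a b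
      using that by (cases i) (simp_all add: pcoord_hom acoord_hom)
  qed (auto simp: H.square test_hom_gx test_hom_gy \<delta>_def)
  then show ?thesis by (simp add: card_Plus mult_2)
qed

section \<open>Finiteness and the direct decomposition of the derived subgroup\<close>

lemma D_iso: "HH n\<lparr>carrier := H.D\<rparr> \<cong> C2_pow (n\<^sup>2 * (n + 1) div 2)"
  unfolding D_eq card_index[symmetric] by (rule derived_sub_basis(1)) simp

lemma finite_HH: "finite (carrier (HH n))"
proof (rule H.finite_if_quotient_finite)
  show "derived (HH n) (carrier (HH n)) \<lhd> HH n" by (rule H.derived_self_is_normal)
  show "finite (derived (HH n) (carrier (HH n)))"
    unfolding H.derived_eq using iso_C2_pow_finite[OF D_iso] by simp
  show "finite (carrier (HH n Mod derived (HH n) (carrier (HH n))))"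
    by (rule iso_C2_pow_finite[OF abelianization_iso])
qed

abbreviation W :: "gen word set set" where "W \<equiv> generate (HH n) H.Cset"

lemma W_iso: "HH n\<lparr>carrier := W\<rparr> \<cong> C2_pow (n\<^sup>2)"
proof -
  have "HH n\<lparr>carrier := W\<rparr> \<cong> C2_pow (card (Inl ` index2 n :: ((nat \<times> nat) + (nat \<times> nat \<times> nat)) set))"
    unfolding Cset_eq by (rule derived_sub_basis(1)) auto
  then show ?thesis by (simp add: card_image card_index2)
qed

lemma F_iso: "HH n\<lparr>carrier := H.F\<rparr> \<cong> C2_pow (n\<^sup>2 * (n - 1) div 2)"
proof -
  have "HH n\<lparr>carrier := H.F\<rparr> \<cong> C2_pow (card (Inr ` index3 n :: ((nat \<times> nat) + (nat \<times> nat \<times> nat)) set))"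
    unfolding F_eq by (rule derived_sub_basis(1)) auto
  then show ?thesis by (simp add: card_image card_index3)
qed

lemma W_subgroup: "subgroup W (HH n)"
  by (rule H.generate_is_subgroup[OF H.Cset_carrier])

lemma W_subset_D: "W \<subseteq> H.D"
  by (rule H.mono_generate) auto

text \<open>Duality gives this on the basis elements and additivity on their span. The empty span is
  included and supplies the value at the identity.\<close>

lemma derived_char_zero:
  assumes "J \<subseteq> index2 n <+> index3 n" "s \<in> index2 n <+> index3 n" "s \<notin> J"
    "d \<in> generate (HH n) (derived_basis n ` J)"
  shows "derived_char n s d = 0"
proof -
  have sub: "generate (HH n) (derived_basis n ` J) \<subseteq> H.D"
    unfolding D_eq by (rule H.mono_generate) (use assms(1) in blast)
  have D: "derived_basis n ` J \<subseteq> H.D" using derived_basis_D assms(1) by blast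
  then have c: "derived_basis n ` J \<subseteq> carrier (HH n)" using H.D_carrier by (rule order.trans)
  have sq: "\<forall>s\<in>derived_basis n ` J. s \<otimes>\<^bsub>HH n\<^esub> s = \<one>\<^bsub>HH n\<^esub>" using D H.D_square by blast
  show ?thesis
    using assms(4) c sq
  proof (induction rule: H.generate_involution_induct)
    case one
    have oD: "\<one>\<^bsub>HH n\<^esub> \<in> H.D" by (rule generate.one)
    show ?case
      using derived_char_mult[OF oD oD, of s] by (cases "derived_char n s \<one>\<^bsub>HH n\<^esub>") simp_all
  next
    case (gen b)
    then obtain t where t: "t \<in> J" "b = derived_basis n t" by blast
    then have "t \<in> index2 n <+> index3 n" "s \<noteq> t" using assms(1,3) by blast+
    then show ?case unfolding t(2) using derived_char_basis[OF assms(2), of t] by simp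
  next
    case (mult a b)
    then have "a \<in> H.D" "b \<in> H.D" using sub by blast+
    then show ?case using derived_char_mult[of a b s] mult by simp
  qed
qed

text \<open>The characters belonging to the \<open>c_ij\<close> separate the elements of
  \<open>W\<close> and vanish on \<open>F\<close>.\<close>

lemma W_Int_F: "W \<inter> H.F = {\<one>\<^bsub>HH n\<^esub>}"
proof
  show "W \<inter> H.F \<subseteq> {\<one>\<^bsub>HH n\<^esub>}"
  proof
    fix d assume d: "d \<in> W \<inter> H.F"
    have one: "\<one>\<^bsub>HH n\<^esub> \<in> generate (HH n) (derived_basis n ` J)" for J by (rule generate.one)
    have "d = \<one>\<^bsub>HH n\<^esub>"
    proof (rule derived_sub_basis(2)[of "Inl ` index2 n"])
      show "derived_char n s d = derived_char n s \<one>\<^bsub>HH n\<^esub>" if s: "s \<in> Inl ` index2 n" for s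
      proof -
        have "derived_char n s d = 0"
          by (rule derived_char_zero[of "Inr ` index3 n"]) (use d s F_eq in auto)
        moreover have "derived_char n s \<one>\<^bsub>HH n\<^esub> = 0"
          by (rule derived_char_zero[of "{}"]) (use s one[of "{}"] in auto)
        ultimately show ?thesis by simp
      qed
    qed (use d one Cset_eq in auto)
    then show "d \<in> {\<one>\<^bsub>HH n\<^esub>}" by simp
  qed
  show "{\<one>\<^bsub>HH n\<^esub>} \<subseteq> W \<inter> H.F" by (auto intro: generate.one)
qed

text \<open>Centrality of \<open>F\<close> lets \<open>w f w' f'\<close> be regrouped as
  \<open>w w'\<close> times \<open>f f'\<close>.\<close>

lemma W_F_decompose:
  assumes "d \<in> H.D"
  obtains w f where "w \<in> W" "f \<in> H.F" "d = w \<otimes>\<^bsub>HH n\<^esub> f"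
proof -
  have S: "H.Cset \<union> H.Eset \<subseteq> carrier (HH n)" using H.Cset_carrier H.Eset_carrier by auto
  have sq: "\<forall>s\<in>H.Cset \<union> H.Eset. s \<otimes>\<^bsub>HH n\<^esub> s = \<one>\<^bsub>HH n\<^esub>" using H.Cset_square H.Eset_square by auto
  have "\<exists>w\<in>W. \<exists>f\<in>H.F. d = w \<otimes>\<^bsub>HH n\<^esub> f"
    using assms S sq
  proof (induction rule: H.generate_involution_induct)
    case one
    show ?case
      by (intro bexI[of _ "\<one>\<^bsub>HH n\<^esub>"]) (auto intro: generate.one)
  next
    case (gen s)
    then have s: "s \<in> carrier (HH n)" using S by auto
    from gen show ?case
    proof
      assume "s \<in> H.Cset"
      then have "s \<in> W" "s = s \<otimes>\<^bsub>HH n\<^esub> \<one>\<^bsub>HH n\<^esub>" using s by (auto intro: generate.incl)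
      then show ?thesis using generate.one by blast
    next
      assume "s \<in> H.Eset"
      then have "s \<in> H.F" "s = \<one>\<^bsub>HH n\<^esub> \<otimes>\<^bsub>HH n\<^esub> s" using s by (auto intro: generate.incl)
      then show ?thesis using generate.one by blast
    qed
  next
    case (mult a b)
    then obtain w f w' f' where wf: "w \<in> W" "f \<in> H.F" "a = w \<otimes>\<^bsub>HH n\<^esub> f"
      "w' \<in> W" "f' \<in> H.F" "b = w' \<otimes>\<^bsub>HH n\<^esub> f'" by blast
    have c: "w \<in> carrier (HH n)" "w' \<in> carrier (HH n)" "f \<in> carrier (HH n)" "f' \<in> carrier (HH n)"
      using wf W_subset_D H.F_carrier H.D_carrier by auto
    have "a \<otimes>\<^bsub>HH n\<^esub> b = w \<otimes>\<^bsub>HH n\<^esub> (f \<otimes>\<^bsub>HH n\<^esub> w') \<otimes>\<^bsub>HH n\<^esub> f'"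
      using wf c by (simp add: H.m_assoc)
    also have "\<dots> = (w \<otimes>\<^bsub>HH n\<^esub> w') \<otimes>\<^bsub>HH n\<^esub> (f \<otimes>\<^bsub>HH n\<^esub> f')"
      using H.F_central[OF wf(2), of w'] c by (simp add: H.m_assoc)
    finally show ?case using wf by (blast intro: generate.eng)
  qed
  then show thesis using that by blast
qed

lemma direct_product: "internal_direct_product (HH n\<lparr>carrier := H.D\<rparr>) W H.F"
proof -
  have D: "comm_group (HH n\<lparr>carrier := H.D\<rparr>)"
    by (rule H.generated_comm_group) (use H.CE_commute H.Cset_carrier H.Eset_carrier in auto)
  have "W <#>\<^bsub>HH n\<lparr>carrier := H.D\<rparr>\<^esub> H.F = H.D"
  proof
    show "W <#>\<^bsub>HH n\<lparr>carrier := H.D\<rparr>\<^esub> H.F \<subseteq> H.D"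
      using W_subset_D H.F_subset_D by (auto simp: set_mult_def intro: generate.eng)
    show "H.D \<subseteq> W <#>\<^bsub>HH n\<lparr>carrier := H.D\<rparr>\<^esub> H.F"
    proof
      fix d assume "d \<in> H.D"
      then obtain w f where "w \<in> W" "f \<in> H.F" "d = w \<otimes>\<^bsub>HH n\<^esub> f" by (rule W_F_decompose)
      then show "d \<in> W <#>\<^bsub>HH n\<lparr>carrier := H.D\<rparr>\<^esub> H.F" by (auto simp: set_mult_def)
    qed
  qed
  moreover have "W \<lhd> HH n\<lparr>carrier := H.D\<rparr>"
    by (rule comm_group.subgroup_imp_normal[OF D H.subgroup_incl[OF W_subgroup H.D_subgroup W_subset_D]])
  moreover have "H.F \<lhd> HH n\<lparr>carrier := H.D\<rparr>"
    by (rule comm_group.subgroup_imp_normal[OF D H.subgroup_incl[OF H.F_subgroup H.D_subgroup H.F_subset_D]])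
  ultimately show ?thesis using W_Int_F by (simp add: internal_direct_product_def)
qed

text \<open>Elements of \<open>D\<close> are involutions, so \<open>ab\<close> serves as the
  quotient of \<open>a\<close> and \<open>b\<close>. Write it as \<open>wf\<close>: the characters
  of the \<open>c_ij\<close> vanish on \<open>ab\<close> by assumption and on \<open>f\<close>,
  hence on \<open>w\<close>, which is therefore trivial.\<close>

lemma F_coset_eqI:
  assumes "a \<in> H.D" "b \<in> H.D"
    and "\<And>ij. ij \<in> index2 n \<Longrightarrow> derived_char n (Inl ij) a = derived_char n (Inl ij) b"
  shows "a <#\<^bsub>HH n\<^esub> H.F = b <#\<^bsub>HH n\<^esub> H.F"
proof -
  have c: "a \<in> carrier (HH n)" "b \<in> carrier (HH n)" using assms H.D_carrier by auto
  have ab: "a \<otimes>\<^bsub>HH n\<^esub> b \<in> H.D" using assms by (blast intro: generate.eng)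
  obtain w f where wf: "w \<in> W" "f \<in> H.F" "a \<otimes>\<^bsub>HH n\<^esub> b = w \<otimes>\<^bsub>HH n\<^esub> f" by (rule W_F_decompose[OF ab])
  have D: "w \<in> H.D" "f \<in> H.D" using wf W_subset_D H.F_subset_D by auto
  have one: "\<one>\<^bsub>HH n\<^esub> \<in> generate (HH n) (derived_basis n ` J)" for J by (rule generate.one)
  have "w = \<one>\<^bsub>HH n\<^esub>"
  proof (rule derived_sub_basis(2)[of "Inl ` index2 n"])
    show "derived_char n s w = derived_char n s \<one>\<^bsub>HH n\<^esub>" if s: "s \<in> Inl ` index2 n" for s
    proof -
      have "derived_char n s f = 0"
        by (rule derived_char_zero[of "Inr ` index3 n"]) (use wf s F_eq in auto)
      moreover have "derived_char n s \<one>\<^bsub>HH n\<^esub> = 0"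
        by (rule derived_char_zero[of "{}"]) (use s one[of "{}"] in auto)
      moreover have "derived_char n s (w \<otimes>\<^bsub>HH n\<^esub> f) = 0"
        unfolding wf(3)[symmetric] derived_char_mult[OF assms(1,2)] using s assms(3) by auto
      ultimately show ?thesis using derived_char_mult[OF D] by simp
    qed
  qed (use wf one Cset_eq in auto)
  then have "a \<otimes>\<^bsub>HH n\<^esub> b = f" using wf D H.D_carrier by auto
  then have "b = a \<otimes>\<^bsub>HH n\<^esub> f" using H.involution_cancel[OF c H.D_square[OF assms(1)]] by simp
  then have "b \<in> a <#\<^bsub>HH n\<^esub> H.F" using wf(2) by (auto simp: l_coset_def)
  then show ?thesis by (rule H.l_repr_independence[OF _ c(1) H.F_subgroup])
qed

lemma extend_automorphisms:
  assumes g1: "g1 \<in> auto (HH n\<lparr>carrier := generate (HH n) (gx n ` {1..n})\<rparr>)"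
    and g2: "g2 \<in> auto (HH n\<lparr>carrier := generate (HH n) (gy n ` {1..n})\<rparr>)"
  obtains \<phi> where "\<phi> \<in> auto (HH n)"
    "\<And>i. i \<in> {1..n} \<Longrightarrow> \<phi> (gx n i) = g1 (gx n i)" "\<And>i. i \<in> {1..n} \<Longrightarrow> \<phi> (gy n i) = g2 (gy n i)"
proof -
  let ?X = "generate (HH n) (gx n ` {1..n})" and ?Y = "generate (HH n) (gy n ` {1..n})"
  have g1': "bij_betw g1 ?X ?X" and h1: "\<And>a b. a \<in> ?X \<Longrightarrow> b \<in> ?X \<Longrightarrow> g1 (a \<otimes>\<^bsub>HH n\<^esub> b) = g1 a \<otimes>\<^bsub>HH n\<^esub> g1 b"
    using g1 by (auto simp: auto_def Bij_def hom_def)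
  have g2': "bij_betw g2 ?Y ?Y" and h2: "\<And>a b. a \<in> ?Y \<Longrightarrow> b \<in> ?Y \<Longrightarrow> g2 (a \<otimes>\<^bsub>HH n\<^esub> b) = g2 a \<otimes>\<^bsub>HH n\<^esub> g2 b"
    using g2 by (auto simp: auto_def Bij_def hom_def)
  have XC: "?X \<subseteq> carrier (HH n)" and YC: "?Y \<subseteq> carrier (HH n)"
    using H.generate_incl H.X0_carrier H.Y0_carrier by blast+
  have X: "g1 (gx n i) \<in> ?X" and Y: "g2 (gy n i) \<in> ?Y" if "i \<in> {1..n}" for i
    using bij_betwE[OF g1'] bij_betwE[OF g2'] that by (simp_all add: generate.incl)
  have "H_relations (HH n) ((\<lambda>i. g1 (gx n i)) ` {1..n}) ((\<lambda>i. g2 (gy n i)) ` {1..n})"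
    by (rule H.H_relations_subset) (use X Y in blast)+
  moreover have "(\<lambda>i. g1 (gx n i)) \<in> {1..n} \<rightarrow> carrier (HH n)" "(\<lambda>i. g2 (gy n i)) \<in> {1..n} \<rightarrow> carrier (HH n)"
    using X Y XC YC by blast+
  ultimately obtain h where h: "h \<in> hom (HH n) (HH n)"
    and hx: "\<And>i. i \<in> {1..n} \<Longrightarrow> h (gx n i) = g1 (gx n i)"
    and hy: "\<And>i. i \<in> {1..n} \<Longrightarrow> h (gy n i) = g2 (gy n i)"
    using HH_universal[OF group_HH] by metis
  have hg: "group_hom (HH n) (HH n) h"
    by (intro group_hom.intro group_hom_axioms.intro group_HH h)
  \<comment> \<open>Agreement on the whole span, beyond its generators, is needed for surjectivity:
    a generator is the image under \<open>g\<close> of some element of the span, and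
    \<open>h\<close> must send that same element to it.\<close>
  have agree: "h a = g a" if "a \<in> generate (HH n) S" "S \<subseteq> carrier (HH n)" "\<forall>s\<in>S. s \<otimes>\<^bsub>HH n\<^esub> s = \<one>\<^bsub>HH n\<^esub>"
      "\<And>s. s \<in> S \<Longrightarrow> h s = g s"
      "\<And>a b. a \<in> generate (HH n) S \<Longrightarrow> b \<in> generate (HH n) S \<Longrightarrow> g (a \<otimes>\<^bsub>HH n\<^esub> b) = g a \<otimes>\<^bsub>HH n\<^esub> g b"
      "g ` generate (HH n) S \<subseteq> carrier (HH n)" for g S a
    using that(1-3)
  proof (induction rule: H.generate_involution_induct)
    case one
    have o: "\<one>\<^bsub>HH n\<^esub> \<in> generate (HH n) S" by (rule generate.one)
    have "g \<one>\<^bsub>HH n\<^esub> \<otimes>\<^bsub>HH n\<^esub> g \<one>\<^bsub>HH n\<^esub> = g \<one>\<^bsub>HH n\<^esub>" using that(5)[OF o o] by simp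
    moreover have "g \<one>\<^bsub>HH n\<^esub> \<in> carrier (HH n)" using that(6) o by blast
    ultimately have "g \<one>\<^bsub>HH n\<^esub> = \<one>\<^bsub>HH n\<^esub>" using H.l_cancel_one' by metis
    then show ?case using group_hom.hom_one[OF hg] by simp
  next
    case (gen s)
    then show ?case using that(4) by blast
  next
    case (mult a b)
    then show ?case using that(5)[of a b] hom_mult[OF h] by simp
  qed
  have hX: "h a = g1 a" if "a \<in> ?X" for a
    by (rule agree[OF that]) (use H.X0_carrier H.square hx h1 g1' XC in \<open>auto simp: bij_betw_def\<close>)
  have hY: "h a = g2 a" if "a \<in> ?Y" for a
    by (rule agree[OF that]) (use H.Y0_carrier H.square hy h2 g2' YC in \<open>auto simp: bij_betw_def\<close>)
  have "?X \<subseteq> h ` carrier (HH n)"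
  proof
    fix a assume "a \<in> ?X"
    then obtain b where "b \<in> ?X" "a = g1 b" using g1' unfolding bij_betw_def by blast
    then show "a \<in> h ` carrier (HH n)" using hX XC by auto
  qed
  moreover have "?Y \<subseteq> h ` carrier (HH n)"
  proof
    fix a assume "a \<in> ?Y"
    then obtain b where "b \<in> ?Y" "a = g2 b" using g2' unfolding bij_betw_def by blast
    then show "a \<in> h ` carrier (HH n)" using hY YC by auto
  qed
  ultimately have "gx n ` {1..n} \<union> gy n ` {1..n} \<subseteq> h ` carrier (HH n)"
    using generate.incl[of _ "gx n ` {1..n}" "HH n"] generate.incl[of _ "gy n ` {1..n}" "HH n"] by blast
  then have "generate (HH n) (gx n ` {1..n} \<union> gy n ` {1..n}) \<subseteq> h ` carrier (HH n)"
    by (rule H.generate_subgroup_incl[OF _ group_hom.img_is_subgroup[OF hg]])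
  then have surj: "h ` carrier (HH n) = carrier (HH n)"
    using hom_carrier[OF h] HH_generated by auto
  then have "inj_on h (carrier (HH n))"
    by (simp add: eq_card_imp_inj_on finite_HH)
  \<comment> \<open>The set \<open>auto\<close> consists of extensional functions, so the map is cut
    down to the carrier.\<close>
  then have "bij_betw (restrict h (carrier (HH n))) (carrier (HH n)) (carrier (HH n))"
    unfolding bij_betw_def inj_on_restrict_eq image_restrict_eq using surj by blast
  moreover have "restrict h (carrier (HH n)) \<in> hom (HH n) (HH n)"
    using h by (auto simp: hom_def Pi_iff)
  ultimately have "restrict h (carrier (HH n)) \<in> auto (HH n)"
    by (simp add: auto_def Bij_def)
  then show thesis
    by (rule that) (use hx hy in auto)
qed

text \<open>The characters of the \<open>c_ij\<close> separate the cosets of \<open>F\<close> in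
  \<open>D\<close>. On the left they give the bilinear form evaluated at the two words, on the right
  a sum over the index pairs; expanding the form letter by letter gives the same sum.\<close>

lemma commutator_coset_product:
  assumes us: "set us \<subseteq> gx n ` {1..n}" and vs: "set vs \<subseteq> gy n ` {1..n}"
    and ps: "distinct ps" "set ps = {..<length us} \<times> {..<length vs}"
  shows "commutator (HH n) (foldr (\<otimes>\<^bsub>HH n\<^esub>) us \<one>\<^bsub>HH n\<^esub>) (foldr (\<otimes>\<^bsub>HH n\<^esub>) vs \<one>\<^bsub>HH n\<^esub>) <#\<^bsub>HH n\<^esub> H.F =
    foldr (\<otimes>\<^bsub>HH n\<^esub>) (map (\<lambda>(u, v). commutator (HH n) (us ! u) (vs ! v)) ps) \<one>\<^bsub>HH n\<^esub> <#\<^bsub>HH n\<^esub> H.F"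
proof -
  let ?G = "HH n"
  let ?c = "foldr (\<otimes>\<^bsub>?G\<^esub>) us \<one>\<^bsub>?G\<^esub>" and ?d = "foldr (\<otimes>\<^bsub>?G\<^esub>) vs \<one>\<^bsub>?G\<^esub>"
  let ?w = "map (\<lambda>(u, v). commutator ?G (us ! u) (vs ! v)) ps"
  have sub: "subgroup (carrier ?G) ?G" by (rule H.subgroup_self)
  have usC: "set us \<subseteq> carrier ?G" and vsC: "set vs \<subseteq> carrier ?G"
    using us vs H.X0_carrier H.Y0_carrier by blast+
  \<comment> \<open>The zero map is additive; only closure under folds is extracted here.\<close>
  have cd: "?c \<in> carrier ?G" "?d \<in> carrier ?G"
    using H.foldr_char(1)[OF sub, of "\<lambda>_. 0"] usC vsC by auto
  have el: "\<exists>i\<in>{1..n}. us ! u = gx n i" "\<exists>j\<in>{1..n}. vs ! v = gy n j"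
    if "(u, v) \<in> set ps" for u v
  proof -
    have "us ! u \<in> set us" "vs ! v \<in> set vs" using that ps(2) by auto
    then show "\<exists>i\<in>{1..n}. us ! u = gx n i" "\<exists>j\<in>{1..n}. vs ! v = gy n j"
      using us vs by blast+
  qed
  have w: "set ?w \<subseteq> H.D"
  proof
    fix a assume "a \<in> set ?w"
    then obtain u v where uv: "(u, v) \<in> set ps" "a = commutator ?G (us ! u) (vs ! v)" by auto
    have "us ! u \<in> carrier ?G" "vs ! v \<in> carrier ?G" using el[OF uv(1)] by auto
    then show "a \<in> H.D" unfolding uv(2) by (rule H.comm_in_D)
  qed
  show ?thesis
  proof (rule F_coset_eqI)
    show "commutator ?G ?c ?d \<in> H.D" using cd by (rule H.comm_in_D)
    show "foldr (\<otimes>\<^bsub>?G\<^esub>) ?w \<one>\<^bsub>?G\<^esub> \<in> H.D"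
      by (rule H.foldr_char(1)[OF H.D_subgroup _ w, of "\<lambda>_. 0"]) simp
    fix ij assume "ij \<in> index2 n"
    obtain i j where ij: "ij = (i, j)" by force
    let ?t = "test_hom n (\<delta> i) (\<lambda>_. 0) (\<delta> j)"
    let ?p = "\<lambda>g. pcoord (?t g)" and ?a = "\<lambda>g. acoord (?t g)"
    have p: "?p (foldr (\<otimes>\<^bsub>?G\<^esub>) ts \<one>\<^bsub>?G\<^esub>) = (\<Sum>u<length ts. ?p (ts ! u))"
      and a: "?a (foldr (\<otimes>\<^bsub>?G\<^esub>) ts \<one>\<^bsub>?G\<^esub>) = (\<Sum>u<length ts. ?a (ts ! u))"
      if "set ts \<subseteq> carrier ?G" for ts
      using H.foldr_char(2)[OF sub _ that, of ?p] H.foldr_char(2)[OF sub _ that, of ?a]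
        pcoord_hom acoord_hom by (simp_all add: sum_list_nth_conv)
    \<comment> \<open>The letters of \<open>us\<close> have zero constant coefficient, which removes
      one of the two terms of the alternating form.\<close>
    have "?a (us ! u) = 0" if "u < length us" for u
      using us nth_mem[OF that] by (auto simp: test_hom_gx)
    then have ac: "?a ?c = 0" using a[OF usC] by simp
    have "derived_char n (Inl ij) (commutator ?G ?c ?d) = ?p ?c * ?a ?d"
      using ac by (simp add: ij hom_commutator[OF group_HH group_wreath test_hom_hom cd] bcoord_commutator)
    also have "\<dots> = (\<Sum>(u, v)\<in>{..<length us} \<times> {..<length vs}. ?p (us ! u) * ?a (vs ! v))"
      by (simp only: p[OF usC] a[OF vsC] sum_product sum.cartesian_product)
    also have "\<dots> = (\<Sum>(u, v)\<in>set ps. ?p (us ! u) * ?a (vs ! v))" by (simp only: ps(2))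
    \<comment> \<open>Each index pair occurs once in \<open>ps\<close>, and sums in
      \<open>bit\<close> do not depend on the order of its entries.\<close>
    also have "\<dots> = sum_list (map (\<lambda>(u, v). ?p (us ! u) * ?a (vs ! v)) ps)"
      by (rule sum_list_distinct_conv_sum_set[OF ps(1), symmetric])
    also have "map (\<lambda>(u, v). ?p (us ! u) * ?a (vs ! v)) ps = map (derived_char n (Inl ij)) ?w"
    proof -
      have "?p (us ! u) * ?a (vs ! v) = derived_char n (Inl ij) (commutator ?G (us ! u) (vs ! v))"
        if "(u, v) \<in> set ps" for u v
        using el[OF that] by (auto simp: ij test_hom_gx test_hom_gy test_hom_basis2)
      then show ?thesis by auto
    qed
    also have "sum_list (map (derived_char n (Inl ij)) ?w) =
        derived_char n (Inl ij) (foldr (\<otimes>\<^bsub>?G\<^esub>) ?w \<one>\<^bsub>?G\<^esub>)"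
      by (rule H.foldr_char(2)[where \<chi> = "derived_char n (Inl ij)",
            OF H.D_subgroup derived_char_mult w, symmetric])
    finally show "derived_char n (Inl ij) (commutator ?G ?c ?d) =
      derived_char n (Inl ij) (foldr (\<otimes>\<^bsub>?G\<^esub>) ?w \<one>\<^bsub>?G\<^esub>)" .
  qed
qed

lemma comm_comm_Y:
  assumes "a \<in> carrier (HH n)" "b \<in> generate (HH n) (gy n ` {1..n})" "b' \<in> generate (HH n) (gy n ` {1..n})"
  shows "commutator (HH n) (commutator (HH n) b a) b' = \<one>\<^bsub>HH n\<^esub>"
    and "commutator (HH n) (commutator (HH n) a b) b' = \<one>\<^bsub>HH n\<^esub>"
proof -
  have c: "b \<in> carrier (HH n)" "b' \<in> carrier (HH n)"
    using assms H.generate_incl[OF H.Y0_carrier] by auto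
  have "commutator (HH n) b a \<in> H.D" "commutator (HH n) a b \<in> H.D"
    using assms(1) c H.comm_in_D by auto
  then show "commutator (HH n) (commutator (HH n) b a) b' = \<one>\<^bsub>HH n\<^esub>"
    "commutator (HH n) (commutator (HH n) a b) b' = \<one>\<^bsub>HH n\<^esub>"
    using assms c H.D_Y[OF _ assms(3)] by (auto simp: H.commutator_eq_one_iff)
qed

lemma mixed_dihedral_HH:
  "mixed_dihedral n (HH n) (generate (HH n) (gx n ` {1..n})) (generate (HH n) (gy n ` {1..n}))"
proof -
  let ?X = "generate (HH n) (gx n ` {1..n})" and ?Y = "generate (HH n) (gy n ` {1..n})"
  have s: "subgroup ?X (HH n)" "subgroup ?Y (HH n)"
    using H.generate_is_subgroup H.X0_carrier H.Y0_carrier by auto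
  have sub: "?X \<union> ?Y \<subseteq> carrier (HH n)" using s subgroup.subset by blast
  have "gx n ` {1..n} \<union> gy n ` {1..n} \<subseteq> ?X \<union> ?Y"
    by (intro Un_mono subsetI generate.incl)
  then have "carrier (HH n) \<subseteq> generate (HH n) (?X \<union> ?Y)"
    unfolding HH_generated by (rule H.mono_generate)
  then have "carrier (HH n) = generate (HH n) (?X \<union> ?Y)"
    by (rule subset_antisym[OF _ H.generate_incl[OF sub]])
  then show ?thesis
    unfolding mixed_dihedral_def
    by (intro conjI s group_HH finite_HH X_iso Y_iso abelianization_iso)
qed

lemma W_generators:
  "{commutator (HH n) (gx n i) (gy n j) |i j. i \<in> {1..n} \<and> j \<in> {1..n}} = H.Cset"
  unfolding H.Cset_def by blast

lemma lower_central_3_generators: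
  "lower_central_3 (HH n) = generate (HH n)
     {commutator (HH n) (commutator (HH n) (gx n i) (gy n j)) (gx n k) |i j k.
        i \<in> {1..n} \<and> j \<in> {1..n} \<and> i < k \<and> k \<le> n}"
proof -
  have "{commutator (HH n) (commutator (HH n) (gx n i) (gy n j)) (gx n k) |i j k.
        i \<in> {1..n} \<and> j \<in> {1..n} \<and> i < k \<and> k \<le> n} = (\<lambda>s. derived_basis n (Inr s)) ` index3 n"
    unfolding index3_def image_def by auto
  then show ?thesis unfolding H.lower_central_3_eq F_eq by (simp add: image_image)
qed

lemma F_subset_centre: "H.F \<subseteq> centre (HH n)"
  using H.F_central H.F_carrier by (auto simp: centre_def)

lemma comm_comm_swap_HH:
  "a \<in> gx n ` {1..n} \<Longrightarrow> a' \<in> gx n ` {1..n} \<Longrightarrow> b \<in> gy n ` {1..n} \<Longrightarrow>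
    commutator (HH n) (commutator (HH n) a b) a' = commutator (HH n) (commutator (HH n) a' b) a"
  by (rule H.comm_comm_swap)

lemmas derived_HH_eq = H.derived_eq
lemmas lower_central_3_HH_eq = H.lower_central_3_eq

end

theorem theorem4p5:
  fixes n :: nat
  assumes "n \<ge> 2"
  shows
    "let G = HH n; x = gx n; y = gy n; comm = commutator G;
         X0 = x ` {1..n}; Y0 = y ` {1..n};
         X = generate G X0; Y = generate G Y0;
         G' = derived G (carrier G); G3 = lower_central_3 G;
         W = generate G {comm (x i) (y j) |i j. i \<in> {1..n} \<and> j \<in> {1..n}}
     in
      \<comment> \<open>(1)\<close>
      (\<forall>a\<in>X0. \<forall>a'\<in>X0. \<forall>b\<in>Y0. comm (comm a b) a' = comm (comm a' b) a) \<and>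
      \<comment> \<open>(2)\<close>
      (G Mod G' \<cong> C2_pow (2 * n) \<and> mixed_dihedral n G X Y) \<and>
      \<comment> \<open>(3)\<close>
      (internal_direct_product (G\<lparr>carrier := G'\<rparr>) W G3 \<and>
       G\<lparr>carrier := G'\<rparr> \<cong> C2_pow (n\<^sup>2 * (n + 1) div 2) \<and>
       G\<lparr>carrier := W\<rparr> \<cong> C2_pow (n\<^sup>2) \<and>
       G3 = generate G {comm (comm (x i) (y j)) (x k) |i j k.
                          i \<in> {1..n} \<and> j \<in> {1..n} \<and> i < k \<and> k \<le> n} \<and>
       G\<lparr>carrier := G3\<rparr> \<cong> C2_pow (n\<^sup>2 * (n - 1) div 2) \<and>
       G3 \<subseteq> centre G) \<and>
      \<comment> \<open>(4)\<close>
      (\<forall>a\<in>carrier G. \<forall>b\<in>Y. \<forall>b'\<in>Y.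
         comm (comm b a) b' = \<one>\<^bsub>G\<^esub> \<and> comm (comm a b) b' = \<one>\<^bsub>G\<^esub>) \<and>
      \<comment> \<open>(5)\<close>
      (\<forall>g1\<in>auto (G\<lparr>carrier := X\<rparr>). \<forall>g2\<in>auto (G\<lparr>carrier := Y\<rparr>).
         \<exists>\<phi>\<in>auto G. \<forall>i\<in>{1..n}. \<phi> (x i) = g1 (x i) \<and> \<phi> (y i) = g2 (y i)) \<and>
      \<comment> \<open>(6); the product over the index pairs is taken in an arbitrary order \<open>ps\<close>\<close>
      (\<forall>c\<in>X. \<forall>d\<in>Y. \<forall>us vs ps.
         set us \<subseteq> X0 \<and> foldr (\<otimes>\<^bsub>G\<^esub>) us \<one>\<^bsub>G\<^esub> = c \<and>
         (\<forall>us'. set us' \<subseteq> X0 \<and> foldr (\<otimes>\<^bsub>G\<^esub>) us' \<one>\<^bsub>G\<^esub> = c \<longrightarrow> length us \<le> length us') \<and>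
         set vs \<subseteq> Y0 \<and> foldr (\<otimes>\<^bsub>G\<^esub>) vs \<one>\<^bsub>G\<^esub> = d \<and>
         (\<forall>vs'. set vs' \<subseteq> Y0 \<and> foldr (\<otimes>\<^bsub>G\<^esub>) vs' \<one>\<^bsub>G\<^esub> = d \<longrightarrow> length vs \<le> length vs') \<and>
         distinct ps \<and> set ps = {..<length us} \<times> {..<length vs} \<longrightarrow>
         comm c d <#\<^bsub>G\<^esub> G3 =
           foldr (\<otimes>\<^bsub>G\<^esub>) (map (\<lambda>(u, v). comm (us ! u) (vs ! v)) ps) \<one>\<^bsub>G\<^esub> <#\<^bsub>G\<^esub> G3)"
  unfolding Let_def
proof (intro conjI ballI allI impI)
  fix a a' b
  assume "a \<in> gx n ` {1..n}" "a' \<in> gx n ` {1..n}" "b \<in> gy n ` {1..n}"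
  then show "commutator (HH n) (commutator (HH n) a b) a' = commutator (HH n) (commutator (HH n) a' b) a"
    by (rule comm_comm_swap_HH)
next
  show "HH n Mod derived (HH n) (carrier (HH n)) \<cong> C2_pow (2 * n)" by (rule abelianization_iso)
  show "mixed_dihedral n (HH n) (generate (HH n) (gx n ` {1..n})) (generate (HH n) (gy n ` {1..n}))"
    by (rule mixed_dihedral_HH)
  show "internal_direct_product (HH n\<lparr>carrier := derived (HH n) (carrier (HH n))\<rparr>)
      (generate (HH n) {commutator (HH n) (gx n i) (gy n j) |i j. i \<in> {1..n} \<and> j \<in> {1..n}})
      (lower_central_3 (HH n))"
    unfolding W_generators derived_HH_eq lower_central_3_HH_eq by (rule direct_product)
  show "HH n\<lparr>carrier := derived (HH n) (carrier (HH n))\<rparr> \<cong> C2_pow (n\<^sup>2 * (n + 1) div 2)"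
    unfolding derived_HH_eq by (rule D_iso)
  show "HH n\<lparr>carrier := generate (HH n) {commutator (HH n) (gx n i) (gy n j) |i j.
      i \<in> {1..n} \<and> j \<in> {1..n}}\<rparr> \<cong> C2_pow (n\<^sup>2)"
    unfolding W_generators by (rule W_iso)
  show "HH n\<lparr>carrier := lower_central_3 (HH n)\<rparr> \<cong> C2_pow (n\<^sup>2 * (n - 1) div 2)"
    unfolding lower_central_3_HH_eq by (rule F_iso)
  show "lower_central_3 (HH n) \<subseteq> centre (HH n)"
    unfolding lower_central_3_HH_eq by (rule F_subset_centre)
next
  fix a b b'
  assume "a \<in> carrier (HH n)" "b \<in> generate (HH n) (gy n ` {1..n})" "b' \<in> generate (HH n) (gy n ` {1..n})"
  then show "commutator (HH n) (commutator (HH n) b a) b' = \<one>\<^bsub>HH n\<^esub>"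
    "commutator (HH n) (commutator (HH n) a b) b' = \<one>\<^bsub>HH n\<^esub>"
    by (rule comm_comm_Y)+
next
  fix g1 g2
  assume "g1 \<in> auto (HH n\<lparr>carrier := generate (HH n) (gx n ` {1..n})\<rparr>)"
    "g2 \<in> auto (HH n\<lparr>carrier := generate (HH n) (gy n ` {1..n})\<rparr>)"
  then obtain \<phi> where "\<phi> \<in> auto (HH n)"
    "\<And>i. i \<in> {1..n} \<Longrightarrow> \<phi> (gx n i) = g1 (gx n i)" "\<And>i. i \<in> {1..n} \<Longrightarrow> \<phi> (gy n i) = g2 (gy n i)"
    using extend_automorphisms by blast
  then show "\<exists>\<phi>\<in>auto (HH n). \<forall>i\<in>{1..n}. \<phi> (gx n i) = g1 (gx n i) \<and> \<phi> (gy n i) = g2 (gy n i)"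
    by blast
next
  fix c d us vs ps
  assume *: "set us \<subseteq> gx n ` {1..n} \<and> foldr (\<otimes>\<^bsub>HH n\<^esub>) us \<one>\<^bsub>HH n\<^esub> = c \<and>
       (\<forall>us'. set us' \<subseteq> gx n ` {1..n} \<and> foldr (\<otimes>\<^bsub>HH n\<^esub>) us' \<one>\<^bsub>HH n\<^esub> = c \<longrightarrow> length us \<le> length us') \<and>
       set vs \<subseteq> gy n ` {1..n} \<and> foldr (\<otimes>\<^bsub>HH n\<^esub>) vs \<one>\<^bsub>HH n\<^esub> = d \<and>
       (\<forall>vs'. set vs' \<subseteq> gy n ` {1..n} \<and> foldr (\<otimes>\<^bsub>HH n\<^esub>) vs' \<one>\<^bsub>HH n\<^esub> = d \<longrightarrow> length vs \<le> length vs') \<and>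
       distinct ps \<and> set ps = {..<length us} \<times> {..<length vs}"
  then have "set us \<subseteq> gx n ` {1..n}" "set vs \<subseteq> gy n ` {1..n}" "distinct ps"
    "set ps = {..<length us} \<times> {..<length vs}"
    by blast+
  from commutator_coset_product[OF this]
  show "commutator (HH n) c d <#\<^bsub>HH n\<^esub> lower_central_3 (HH n) =
    foldr (\<otimes>\<^bsub>HH n\<^esub>) (map (\<lambda>(u, v). commutator (HH n) (us ! u) (vs ! v)) ps) \<one>\<^bsub>HH n\<^esub> <#\<^bsub>HH n\<^esub>
      lower_central_3 (HH n)"
    unfolding lower_central_3_HH_eq using * by metis
qed (rule lower_central_3_generators)

end
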